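(* Let $H$ be a (separable) Hilbert space and let $U\subset\mathscr P(H)$ be bounded with respect to the Thompson metric $d$. Then $U$ has a (finite) circumradius $r^*$ and a midpoint, i.e. there is $x^*\in\mathscr P(H)$ with $d(x^*,u)\leq r^*$ for all $u\in U$.
   Context: $\mathscr P(H)\subset B(H)$ is the set of positive invertible bounded operators on $H$, with the Thompson metric $d(x,y)=\Vert\ln(x^{-1/2}yx^{-1/2})\Vert$. The circumradius of a $d$-bounded set $U\subset\mathscr P(H)$ is the infimum $r^*$ of all radii $r\geq 0$ for which there exists $x_r\in\mathscr P(H)$ with $U\subset\overline{B(x_r,r)}=\{y\in\mathscr P(H):d(x_r,y)\leq r\}$. A point $x^*\in\mathscr P(H)$ with $U\subset\overline{B(x^*,r^* )}$ is called a midpoint of $U$. *)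

theory Defs
  imports "HOL-Analysis.Analysis" "HOL-Computational_Algebra.Polynomial"
begin

text \<open>
  Complex Hilbert spaces. The inner product is conjugate-linear in the first argument.
  Completeness comes from the superclass \<^class>\<open>banach\<close>; positive definiteness
  is a consequence of \<open>cinner_self\<close> and the norm axioms.
\<close>

class complex_hilbert_space = banach +
  fixes scaleC :: "complex \<Rightarrow> 'a \<Rightarrow> 'a" (infixr "*\<^sub>C" 75)
    and cinner :: "'a \<Rightarrow> 'a \<Rightarrow> complex"
  assumes scaleC_add_right: "c *\<^sub>C (x + y) = c *\<^sub>C x + c *\<^sub>C y"
    and scaleC_add_left: "(b + c) *\<^sub>C x = b *\<^sub>C x + c *\<^sub>C x"
    and scaleC_scaleC: "b *\<^sub>C (c *\<^sub>C x) = (b * c) *\<^sub>C x"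
    and scaleC_of_real: "complex_of_real r *\<^sub>C x = r *\<^sub>R x"
    and cinner_commute: "cinner x y = cnj (cinner y x)"
    and cinner_add_right: "cinner x (y + z) = cinner x y + cinner x z"
    and cinner_scaleC_right: "cinner x (c *\<^sub>C y) = c * cinner x y"
    and cinner_self: "cinner x x = complex_of_real ((norm x)\<^sup>2)"

text \<open>
  The library type of bounded linear maps is real-linear; \<open>B(H)\<close> is the set of those
  that are complex-linear. The operator norm is the norm of the library type.
\<close>

definition bounded_ops :: "('a::complex_hilbert_space \<Rightarrow>\<^sub>L 'a) set" where
  "bounded_ops = {A. \<forall>c x. blinfun_apply A (c *\<^sub>C x) = c *\<^sub>C blinfun_apply A x}"

definition op_invertible :: "('a::complex_hilbert_space \<Rightarrow>\<^sub>L 'a) \<Rightarrow> bool" where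
  "op_invertible A \<longleftrightarrow>
     (\<exists>B\<in>bounded_ops. A o\<^sub>L B = id_blinfun \<and> B o\<^sub>L A = id_blinfun)"

definition op_positive :: "('a::complex_hilbert_space \<Rightarrow>\<^sub>L 'a) \<Rightarrow> bool" where
  "op_positive A \<longleftrightarrow> (\<forall>x. cinner x (blinfun_apply A x) \<in> \<real>\<^sub>\<ge>\<^sub>0)"

definition pos_inv_ops :: "('a::complex_hilbert_space \<Rightarrow>\<^sub>L 'a) set" where
  "pos_inv_ops = {A \<in> bounded_ops. op_positive A \<and> op_invertible A}"

definition op_spectrum :: "('a::complex_hilbert_space \<Rightarrow>\<^sub>L 'a) \<Rightarrow> complex set" where
  "op_spectrum A = {z. \<not> op_invertible (A - Blinfun (\<lambda>x. z *\<^sub>C x))}"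

definition op_poly :: "real poly \<Rightarrow> ('a::complex_hilbert_space \<Rightarrow>\<^sub>L 'a) \<Rightarrow> ('a \<Rightarrow>\<^sub>L 'a)" where
  "op_poly p A = (\<Sum>i\<le>degree p. coeff p i *\<^sub>R (((\<lambda>B. A o\<^sub>L B) ^^ i) id_blinfun))"

text \<open>
  Continuous functional calculus for a self-adjoint \<open>A\<close> (so that the spectrum is a compact
  set of reals) and a real function \<open>f\<close> continuous on the spectrum: \<open>f(A)\<close> is the
  operator-norm limit of \<open>p\<^sub>n(A)\<close> for every sequence of real polynomials \<open>p\<^sub>n\<close>
  converging to \<open>f\<close> uniformly on the spectrum.
\<close>

definition op_fun :: "(real \<Rightarrow> real) \<Rightarrow> ('a::complex_hilbert_space \<Rightarrow>\<^sub>L 'a) \<Rightarrow> ('a \<Rightarrow>\<^sub>L 'a)" where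
  "op_fun f A =
     (THE B. \<forall>p :: nat \<Rightarrow> real poly.
        uniform_limit {t. complex_of_real t \<in> op_spectrum A} (\<lambda>n. poly (p n)) f sequentially
          \<longrightarrow> (\<lambda>n. op_poly (p n) A) \<longlonglongrightarrow> B)"

definition thompson_dist ::
    "('a::complex_hilbert_space \<Rightarrow>\<^sub>L 'a) \<Rightarrow> ('a \<Rightarrow>\<^sub>L 'a) \<Rightarrow> real" where
  "thompson_dist x y =
     (let s = op_fun (\<lambda>t. t powr (-1/2)) x in norm (op_fun ln (s o\<^sub>L y o\<^sub>L s)))"

definition thompson_cball ::
    "('a::complex_hilbert_space \<Rightarrow>\<^sub>L 'a) \<Rightarrow> real \<Rightarrow> ('a \<Rightarrow>\<^sub>L 'a) set" where
  "thompson_cball x r = {y \<in> pos_inv_ops. thompson_dist x y \<le> r}"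

definition thompson_bounded :: "('a::complex_hilbert_space \<Rightarrow>\<^sub>L 'a) set \<Rightarrow> bool" where
  "thompson_bounded U \<longleftrightarrow> (\<exists>x\<in>pos_inv_ops. \<exists>r. U \<subseteq> thompson_cball x r)"

text \<open>
  The infimum is taken in the extended reals, so that it is \<open>\<infinity>\<close> if there is no
  admissible radius.
\<close>

definition circumradius :: "('a::complex_hilbert_space \<Rightarrow>\<^sub>L 'a) set \<Rightarrow> ereal" where
  "circumradius U = Inf (ereal ` {r. 0 \<le> r \<and> (\<exists>x\<in>pos_inv_ops. U \<subseteq> thompson_cball x r)})"

end

theory Submission
  imports Defs "HOL-Computational_Algebra.Fundamental_Theorem_Algebra"
begin

text \<open>
  By the functional calculus, \<open>d(x, y) \<le> r\<close> holds iff \<open>e\<^sup>-\<^sup>r x \<le> y \<le> e\<^sup>r x\<close> in the order of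
  quadratic forms, a condition that is stable under limits in the weak operator topology.
  Choose centres \<open>x\<^sub>n\<close> whose balls contain \<open>U\<close> and whose radii decrease to the circumradius
  \<open>r\<^sup>*\<close>. They are bounded in norm, so they have a weak cluster point, and this
  point is a midpoint; it is invertible because it dominates a positive multiple of any \<open>u \<in> U\<close>.
\<close>

subsection \<open>Self-adjoint operators and the real inner product\<close>

text \<open>The formula for d(x, y) contains x^(-1/2), and neither inverses nor square roots are
  continuous in the weak operator topology, so the distance itself cannot be passed to the limit. In
  order form the condition is linear in x at each fixed vector, and the radius enters only through a
  scalar factor; hence the weight of the proof lies in that equivalence. The functional calculus
  \<open>op_fun\<close> is a definite description over approximating polynomial sequences and yields
  nothing until the norm of p(A) is bounded by the supremum of |p| on the spectrum. This estimate
  rests on two facts: the norm of a self-adjoint operator, up to sign, lies in its spectrum, and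
  real polynomials split into linear factors and quadratic factors without real roots. The real part
  of the inner product is used throughout because it is bounded bilinear over the reals and still
  determines vectors.\<close>

definition rinner :: "'a::complex_hilbert_space \<Rightarrow> 'a \<Rightarrow> real" where
  "rinner x y = Re (cinner x y)"

lemma rinner_commute: "rinner x y = rinner y x"
  by (metis cinner_commute complex_cnj rinner_def complex.sel(1) complex.collapse)

lemma rinner_add_right: "rinner x (y + z) = rinner x y + rinner x z"
  by (simp add: rinner_def cinner_add_right)

lemma rinner_add_left: "rinner (x + y) z = rinner x z + rinner y z"
  by (metis rinner_add_right rinner_commute)

lemma rinner_scaleR_right: "rinner x (r *\<^sub>R y) = r * rinner x y"
  by (simp add: rinner_def cinner_scaleC_right flip: scaleC_of_real)

lemma rinner_scaleR_left: "rinner (r *\<^sub>R x) y = r * rinner x y"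
  by (metis rinner_scaleR_right rinner_commute)

lemma rinner_self: "rinner x x = (norm x)\<^sup>2"
  by (simp add: rinner_def cinner_self)

lemma cinner_scaleC_left: "cinner (c *\<^sub>C x) y = cnj c * cinner x y"
  by (metis cinner_commute cinner_scaleC_right complex_cnj_mult)

text \<open>The usual derivation reversed: the triangle inequality is an axiom of the norm, and
  squaring it gives Cauchy-Schwarz.\<close>

lemma rinner_le_norm: "rinner x y \<le> norm x * norm y"
proof -
  have "(norm (x + y))\<^sup>2 \<le> (norm x + norm y)\<^sup>2"
    by (simp add: norm_triangle_ineq power_mono)
  moreover have "(norm (x + y))\<^sup>2 = (norm x)\<^sup>2 + 2 * rinner x y + (norm y)\<^sup>2"
    by (simp add: rinner_self[symmetric] rinner_add_left rinner_add_right rinner_commute[of y x])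
  ultimately show ?thesis
    by (simp add: power2_sum)
qed

lemma abs_rinner_le_norm: "\<bar>rinner x y\<bar> \<le> norm x * norm y"
  using rinner_le_norm[of x y] rinner_le_norm[of "- 1 *\<^sub>R x" y]
  by (simp only: rinner_scaleR_left) auto

interpretation rinner: bounded_bilinear rinner
proof
  show "\<exists>K. \<forall>a b. norm (rinner a b) \<le> norm a * norm b * K"
    by (rule exI[of _ 1]) (simp add: abs_rinner_le_norm)
qed (simp_all add: rinner_add_right rinner_add_left rinner_scaleR_left rinner_scaleR_right)

lemma abs_rinner_blinfun_le: "\<bar>rinner x (blinfun_apply A x)\<bar> \<le> norm A * (norm x)\<^sup>2"
proof -
  have "\<bar>rinner x (blinfun_apply A x)\<bar> \<le> norm x * (norm A * norm x)"
    using abs_rinner_le_norm by (rule order_trans) (intro mult_left_mono norm_blinfun norm_ge_zero)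
  then show ?thesis by (simp add: power2_eq_square mult_ac)
qed

lemma power2_norm_add: "(norm (x + y))\<^sup>2 = (norm x)\<^sup>2 + 2 * rinner x y + (norm y)\<^sup>2"
  by (simp add: rinner_self[symmetric] rinner_add_left rinner_add_right rinner_commute[of y x])

lemma power2_norm_diff: "(norm (x - y))\<^sup>2 = (norm x)\<^sup>2 - 2 * rinner x y + (norm y)\<^sup>2"
  using power2_norm_add[of x "-y"] by (simp add: rinner.minus_right)

lemma rinner_eqI: "(\<And>z. rinner z x = rinner z y) \<Longrightarrow> x = (y :: 'a::complex_hilbert_space)"
proof -
  assume "\<And>z. rinner z x = rinner z y"
  then have "rinner (x - y) (x - y) = 0"
    by (simp add: rinner.diff_right)
  then show ?thesis by (simp add: rinner_self)
qed

lemma rinner_scaleC_right: "rinner x (c *\<^sub>C y) = rinner (cnj c *\<^sub>C x) y"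
  by (simp add: rinner_def cinner_scaleC_right cinner_scaleC_left)

text \<open>Symmetry with respect to the real part of the inner product amounts to
  self-adjointness, because the operators in question are complex-linear.\<close>

definition herm_ops :: "('a::complex_hilbert_space \<Rightarrow>\<^sub>L 'a) set" where
  "herm_ops = {A \<in> bounded_ops. \<forall>x y. rinner x (blinfun_apply A y) = rinner (blinfun_apply A x) y}"

lemma bounded_opsD: "A \<in> bounded_ops \<Longrightarrow> blinfun_apply A (c *\<^sub>C x) = c *\<^sub>C blinfun_apply A x"
  by (simp add: bounded_ops_def)

lemma scaleC_0_right: "c *\<^sub>C (0::'a::complex_hilbert_space) = 0"
  using scaleC_add_right[of c 0 0] by simp

lemma scaleC_minus_right: "c *\<^sub>C (- x) = - (c *\<^sub>C (x::'a::complex_hilbert_space))"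
  using scaleC_add_right[of c x "-x"] by (simp add: scaleC_0_right eq_neg_iff_add_eq_0 add.commute)

lemma scaleC_diff_right: "c *\<^sub>C (x - y) = c *\<^sub>C x - c *\<^sub>C (y::'a::complex_hilbert_space)"
  using scaleC_add_right[of c x "-y"] by (simp add: scaleC_minus_right)

lemma scaleC_scaleR: "c *\<^sub>C (r *\<^sub>R x) = r *\<^sub>R (c *\<^sub>C (x::'a::complex_hilbert_space))"
  by (metis mult.commute scaleC_of_real scaleC_scaleC)

lemma bounded_ops_id: "id_blinfun \<in> bounded_ops"
  by (simp add: bounded_ops_def)

lemma bounded_ops_0: "0 \<in> bounded_ops"
  by (simp add: bounded_ops_def scaleC_0_right)

lemma bounded_ops_add: "A \<in> bounded_ops \<Longrightarrow> B \<in> bounded_ops \<Longrightarrow> A + B \<in> bounded_ops"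
  by (simp add: bounded_ops_def blinfun.add_left scaleC_add_right)

lemma bounded_ops_diff: "A \<in> bounded_ops \<Longrightarrow> B \<in> bounded_ops \<Longrightarrow> A - B \<in> bounded_ops"
  by (simp add: bounded_ops_def blinfun.diff_left scaleC_diff_right)

lemma bounded_ops_scaleR: "A \<in> bounded_ops \<Longrightarrow> r *\<^sub>R A \<in> bounded_ops"
  by (simp add: bounded_ops_def blinfun.scaleR_left scaleC_scaleR)

lemma bounded_ops_compose: "A \<in> bounded_ops \<Longrightarrow> B \<in> bounded_ops \<Longrightarrow> A o\<^sub>L B \<in> bounded_ops"
  by (simp add: bounded_ops_def)

lemmas bounded_ops_intros =
  bounded_ops_id bounded_ops_0 bounded_ops_add bounded_ops_diff bounded_ops_scaleR bounded_ops_compose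

lemma herm_opsD: "A \<in> herm_ops \<Longrightarrow> rinner x (blinfun_apply A y) = rinner (blinfun_apply A x) y"
  by (simp add: herm_ops_def)

lemma herm_ops_bounded: "A \<in> herm_ops \<Longrightarrow> A \<in> bounded_ops"
  by (simp add: herm_ops_def)

lemma herm_ops_id: "id_blinfun \<in> herm_ops"
  by (simp add: herm_ops_def bounded_ops_id)

lemma herm_ops_0: "0 \<in> herm_ops"
  by (simp add: herm_ops_def bounded_ops_0 rinner.zero_left rinner.zero_right)

lemma herm_ops_add: "A \<in> herm_ops \<Longrightarrow> B \<in> herm_ops \<Longrightarrow> A + B \<in> herm_ops"
  by (simp add: herm_ops_def bounded_ops_add blinfun.add_left rinner.add_left rinner.add_right)

lemma herm_ops_diff: "A \<in> herm_ops \<Longrightarrow> B \<in> herm_ops \<Longrightarrow> A - B \<in> herm_ops"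
  by (simp add: herm_ops_def bounded_ops_diff blinfun.diff_left rinner.diff_left rinner.diff_right)

lemma herm_ops_scaleR: "A \<in> herm_ops \<Longrightarrow> r *\<^sub>R A \<in> herm_ops"
  by (simp add: herm_ops_def bounded_ops_scaleR blinfun.scaleR_left rinner.scaleR_left rinner.scaleR_right)

lemma herm_ops_compose:
  "A \<in> herm_ops \<Longrightarrow> B \<in> herm_ops \<Longrightarrow> A o\<^sub>L B = B o\<^sub>L A \<Longrightarrow> A o\<^sub>L B \<in> herm_ops"
  unfolding herm_ops_def
  by (auto simp: bounded_ops_compose) (metis blinfun_apply_blinfun_compose)

lemmas herm_ops_intros = herm_ops_id herm_ops_0 herm_ops_add herm_ops_diff herm_ops_scaleR

text \<open>The Lax-Milgram argument: A x = y is solved by a fixed point of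
  \<open>x - \<rho> *\<^sub>R (A x - y)\<close>, a contraction for suitable \<rho>. Coercivity and
  Cauchy-Schwarz also give injectivity and the bound 1/c on the inverse.\<close>

lemma coercive_imp_op_invertible:
  fixes A :: "'a::complex_hilbert_space \<Rightarrow>\<^sub>L 'a"
  assumes A: "A \<in> bounded_ops" and c: "0 < c"
    and coercive: "\<And>x. c * (norm x)\<^sup>2 \<le> rinner x (blinfun_apply A x)"
  shows "op_invertible A"
proof -
  define K where "K = norm A + c"
  have K: "0 < K" "c \<le> K" "norm A \<le> K"
    using c by (auto simp: K_def add_nonneg_pos)
  \<comment> \<open>This \<rho> minimises 1 - 2 \<rho> c + \<rho>^2 K^2, and the minimum is the
    square of \<open>q\<close>. Adding c to the norm in \<open>K\<close> ensures both 0 < K and c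
    \<le> K, so that the root in \<open>q\<close> is taken of a nonnegative number.\<close>
  define \<rho> where "\<rho> = c / K\<^sup>2"
  define q where "q = sqrt (1 - c\<^sup>2 / K\<^sup>2)"
  have \<rho>: "0 < \<rho>" using K c by (simp add: \<rho>_def)
  have cK: "0 < c\<^sup>2 / K\<^sup>2" "c\<^sup>2 / K\<^sup>2 \<le> 1"
    using K c by (auto simp: divide_simps power_mono)
  have q: "0 \<le> q" "q < 1" "q\<^sup>2 = 1 - c\<^sup>2 / K\<^sup>2"
    using cK by (auto simp: q_def)
  have contr: "norm (x - \<rho> *\<^sub>R blinfun_apply A x) \<le> q * norm x" for x
  proof (rule power2_le_imp_le)
    have nA: "norm (blinfun_apply A x) \<le> K * norm x"
      using norm_blinfun[of A x] K(3) by (meson mult_right_mono norm_ge_zero order_trans)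
    have "(norm (x - \<rho> *\<^sub>R blinfun_apply A x))\<^sup>2
        = (norm x)\<^sup>2 - 2 * \<rho> * rinner x (blinfun_apply A x) + \<rho>\<^sup>2 * (norm (blinfun_apply A x))\<^sup>2"
      using \<rho> by (simp add: power2_norm_diff rinner.scaleR_right power_mult_distrib)
    also have "\<dots> \<le> (norm x)\<^sup>2 - 2 * \<rho> * (c * (norm x)\<^sup>2) + \<rho>\<^sup>2 * (K * norm x)\<^sup>2"
      using \<rho> coercive[of x] nA
      by (intro add_mono diff_mono mult_left_mono power_mono) auto
    also have "\<dots> = (q * norm x)\<^sup>2"
    proof -
      have t: "\<rho> * c = c\<^sup>2 / K\<^sup>2" "\<rho>\<^sup>2 * K\<^sup>2 = c\<^sup>2 / K\<^sup>2"
        using K(1) by (simp_all add: \<rho>_def power2_eq_square)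
      have "(norm x)\<^sup>2 - 2 * \<rho> * (c * (norm x)\<^sup>2) + \<rho>\<^sup>2 * (K * norm x)\<^sup>2
          = (1 - 2 * (\<rho> * c) + \<rho>\<^sup>2 * K\<^sup>2) * (norm x)\<^sup>2"
        by (simp add: algebra_simps power_mult_distrib)
      also have "\<dots> = (q * norm x)\<^sup>2"
        unfolding t power_mult_distrib q(3) by simp
      finally show ?thesis .
    qed
    finally show "(norm (x - \<rho> *\<^sub>R blinfun_apply A x))\<^sup>2 \<le> (q * norm x)\<^sup>2" .
  qed (use q in auto)
  have ex: "\<exists>x. blinfun_apply A x = y" for y
  proof -
    define f where "f = (\<lambda>x. x - \<rho> *\<^sub>R (blinfun_apply A x - y))"
    have "dist (f u) (f v) \<le> q * dist u v" for u v
    proof -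
      have "f u - f v = (u - v) - \<rho> *\<^sub>R blinfun_apply A (u - v)"
        by (simp add: f_def blinfun.diff_right scaleR_diff_right)
      then show ?thesis by (simp add: dist_norm contr)
    qed
    then have "\<exists>!x. f x = x"
      using q by (intro banach_fix_type[of q]) auto
    then obtain x where "f x = x" by blast
    then show ?thesis using \<rho> by (intro exI[of _ x]) (simp add: f_def)
  qed
  have below: "c * norm x \<le> norm (blinfun_apply A x)" for x
  proof (cases "x = 0")
    case False
    have "c * (norm x)\<^sup>2 \<le> norm x * norm (blinfun_apply A x)"
      using coercive[of x] rinner_le_norm order_trans by blast
    then show ?thesis using False by (simp add: power2_eq_square)
  qed simp
  have inj: "x = y" if "blinfun_apply A x = blinfun_apply A y" for x y
    using below[of "x - y"] c that by (simp add: blinfun.diff_right mult_le_0_iff)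
  define g where "g y = (SOME x. blinfun_apply A x = y)" for y
  have Ag: "blinfun_apply A (g y) = y" for y
    unfolding g_def using ex by (rule someI_ex)
  have gA: "g (blinfun_apply A x) = x" for x
    by (rule inj) (rule Ag)
  have bl: "bounded_linear g"
  proof (rule bounded_linear_intro)
    show "g (x + y) = g x + g y" for x y
      by (rule inj) (simp add: Ag blinfun.add_right)
    show "g (r *\<^sub>R x) = r *\<^sub>R g x" for r x
      by (rule inj) (simp add: Ag blinfun.scaleR_right)
    show "norm (g x) \<le> norm x * (1 / c)" for x
      using below[of "g x"] c by (simp add: Ag field_simps)
  qed
  have "Blinfun g \<in> bounded_ops"
    unfolding bounded_ops_def mem_Collect_eq bounded_linear_Blinfun_apply[OF bl]
    by (intro allI, rule inj) (simp only: Ag bounded_opsD[OF A])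
  moreover have "A o\<^sub>L Blinfun g = id_blinfun" "Blinfun g o\<^sub>L A = id_blinfun"
    by (rule blinfun_eqI; simp add: bounded_linear_Blinfun_apply[OF bl] Ag gA)+
  ultimately show ?thesis
    by (auto simp: op_invertible_def)
qed

lemma blinfun_compose_assoc: "(A o\<^sub>L B) o\<^sub>L C = A o\<^sub>L (B o\<^sub>L C)"
  by (auto intro: blinfun_eqI)

lemma blinfun_compose_id [simp]: "A o\<^sub>L id_blinfun = A" "id_blinfun o\<^sub>L A = A"
  by (auto intro: blinfun_eqI)

lemma op_invertible_compose:
  assumes "op_invertible A" "op_invertible B"
  shows "op_invertible (A o\<^sub>L B)"
proof -
  obtain A' B' where *: "A' \<in> bounded_ops" "A o\<^sub>L A' = id_blinfun" "A' o\<^sub>L A = id_blinfun"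
    "B' \<in> bounded_ops" "B o\<^sub>L B' = id_blinfun" "B' o\<^sub>L B = id_blinfun"
    using assms by (auto simp: op_invertible_def)
  have pt: "blinfun_apply A (blinfun_apply A' x) = x" "blinfun_apply A' (blinfun_apply A x) = x"
    "blinfun_apply B (blinfun_apply B' x) = x" "blinfun_apply B' (blinfun_apply B x) = x" for x
    using * by (metis blinfun_apply_blinfun_compose blinfun_apply_id_blinfun id_apply)+
  have "(A o\<^sub>L B) o\<^sub>L (B' o\<^sub>L A') = id_blinfun" "(B' o\<^sub>L A') o\<^sub>L (A o\<^sub>L B) = id_blinfun"
    by (rule blinfun_eqI; simp add: pt)+
  then show ?thesis
    using * unfolding op_invertible_def by (meson bounded_ops_compose)
qed

text \<open>If C inverts the product, then \<open>B o\<^sub>L C\<close> is a right inverse of A and,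
  by commutation, \<open>C o\<^sub>L B\<close> a left inverse; the two must agree.\<close>

lemma op_invertible_factor:
  assumes "op_invertible (A o\<^sub>L B)" "A o\<^sub>L B = B o\<^sub>L A" "B \<in> bounded_ops"
  shows "op_invertible A"
proof -
  obtain C where C: "C \<in> bounded_ops" "A o\<^sub>L B o\<^sub>L C = id_blinfun" "C o\<^sub>L (A o\<^sub>L B) = id_blinfun"
    using assms(1) by (auto simp: op_invertible_def)
  have r: "A o\<^sub>L (B o\<^sub>L C) = id_blinfun"
    using C(2) by (simp only: blinfun_compose_assoc)
  have l: "(C o\<^sub>L B) o\<^sub>L A = id_blinfun"
    using C(3) by (simp only: blinfun_compose_assoc assms(2))
  have "C o\<^sub>L B = (C o\<^sub>L B) o\<^sub>L (A o\<^sub>L (B o\<^sub>L C))"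
    by (simp only: r blinfun_compose_id)
  also have "\<dots> = ((C o\<^sub>L B) o\<^sub>L A) o\<^sub>L (B o\<^sub>L C)"
    by (simp only: blinfun_compose_assoc)
  also have "\<dots> = B o\<^sub>L C"
    by (simp only: l blinfun_compose_id)
  finally have "C o\<^sub>L B = B o\<^sub>L C" .
  then show ?thesis
    unfolding op_invertible_def using r l C assms(3) by (metis bounded_ops_compose)
qed

subsection \<open>Polynomials in a self-adjoint operator and its spectrum\<close>

lemma op_poly_0 [simp]: "op_poly 0 A = 0"
  by (simp add: op_poly_def)

text \<open>Horner's scheme: it replaces the sum up to the degree, so that the algebra of
  \<open>op_poly\<close> follows by induction on coefficients.\<close>

lemma op_poly_pCons: "op_poly (pCons a p) A = a *\<^sub>R id_blinfun + (A o\<^sub>L op_poly p A)"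
proof (cases "p = 0")
  case True
  then show ?thesis by (simp add: op_poly_def)
next
  case False
  then show ?thesis
    by (simp add: op_poly_def degree_pCons_eq sum.atMost_Suc_shift
        bounded_bilinear.sum_right[OF bounded_bilinear_blinfun_compose]
        bounded_bilinear.scaleR_right[OF bounded_bilinear_blinfun_compose] del: sum.atMost_Suc)
qed

lemma op_poly_const: "op_poly [:a:] A = a *\<^sub>R id_blinfun"
  by (simp add: op_poly_pCons)

lemma op_poly_linear: "op_poly [:a, 1:] A = a *\<^sub>R id_blinfun + A"
  by (simp add: op_poly_pCons)

lemma op_poly_add: "op_poly (p + q) A = op_poly p A + op_poly q A"
proof (induction p q rule: poly_induct2)
  case (pCons a p b q)
  then show ?case
    by (simp add: op_poly_pCons scaleR_add_left
        bounded_bilinear.add_right[OF bounded_bilinear_blinfun_compose])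
qed simp

lemma op_poly_smult: "op_poly (smult c p) A = c *\<^sub>R op_poly p A"
proof (induction p)
  case (pCons a p)
  then show ?case
    by (simp add: op_poly_pCons scaleR_add_right
        bounded_bilinear.scaleR_right[OF bounded_bilinear_blinfun_compose])
qed simp

lemma op_poly_diff: "op_poly (p - q) A = op_poly p A - op_poly q A"
  using op_poly_add[of p "smult (-1) q" A] unfolding op_poly_smult by simp

lemma op_poly_mult: "op_poly (p * q) A = op_poly p A o\<^sub>L op_poly q A"
proof (induction p)
  case (pCons a p)
  then show ?case
    by (simp add: op_poly_pCons op_poly_add op_poly_smult blinfun_compose_assoc
        bounded_bilinear.add_left[OF bounded_bilinear_blinfun_compose]
        bounded_bilinear.scaleR_left[OF bounded_bilinear_blinfun_compose])
qed simp

lemma op_poly_commute: "op_poly p A o\<^sub>L op_poly q A = op_poly q A o\<^sub>L op_poly p A"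
  by (metis op_poly_mult mult.commute)

lemma op_poly_herm: "A \<in> herm_ops \<Longrightarrow> op_poly p A \<in> herm_ops"
proof (induction p)
  case (pCons a p)
  have "A o\<^sub>L op_poly p A = op_poly p A o\<^sub>L A"
    using op_poly_commute[of "[:0, 1:]" A p] by (simp add: op_poly_linear)
  then show ?case
    using pCons by (simp add: op_poly_pCons herm_ops_intros herm_ops_compose)
qed (simp add: herm_ops_0)

text \<open>The set on which \<open>op_fun\<close> asks for uniform convergence, expressed with real
  scalars only.\<close>

definition real_spectrum :: "('a::complex_hilbert_space \<Rightarrow>\<^sub>L 'a) \<Rightarrow> real set" where
  "real_spectrum A = {t. \<not> op_invertible (A - t *\<^sub>R id_blinfun)}"

lemma real_spectrum_eq: "{t. complex_of_real t \<in> op_spectrum A} = real_spectrum A"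
proof -
  have "Blinfun (\<lambda>x::'a. complex_of_real t *\<^sub>C x) = t *\<^sub>R id_blinfun" for t
  proof (rule blinfun_eqI)
    fix x :: 'a
    have "bounded_linear (\<lambda>x::'a. complex_of_real t *\<^sub>C x)"
      by (simp add: scaleC_of_real bounded_linear_scaleR_right)
    then show "blinfun_apply (Blinfun (\<lambda>x::'a. complex_of_real t *\<^sub>C x)) x
        = blinfun_apply (t *\<^sub>R id_blinfun) x"
      by (simp add: bounded_linear_Blinfun_apply scaleC_of_real blinfun.scaleR_left)
  qed
  then show ?thesis
    by (simp add: real_spectrum_def op_spectrum_def)
qed

lemma op_invertible_scaleR:
  assumes "op_invertible A" "r \<noteq> 0"
  shows "op_invertible (r *\<^sub>R A)"
proof -
  obtain B where B: "B \<in> bounded_ops" "A o\<^sub>L B = id_blinfun" "B o\<^sub>L A = id_blinfun"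
    using assms by (auto simp: op_invertible_def)
  then have "(r *\<^sub>R A) o\<^sub>L ((1/r) *\<^sub>R B) = id_blinfun" "((1/r) *\<^sub>R B) o\<^sub>L (r *\<^sub>R A) = id_blinfun"
    using assms(2)
    by (simp_all add: bounded_bilinear.scaleR_left[OF bounded_bilinear_blinfun_compose]
        bounded_bilinear.scaleR_right[OF bounded_bilinear_blinfun_compose])
  then show ?thesis
    using B(1) unfolding op_invertible_def by (meson bounded_ops_scaleR)
qed

lemma op_invertible_bounded_below:
  assumes "op_invertible (A :: 'a::complex_hilbert_space \<Rightarrow>\<^sub>L 'a)"
  obtains c where "0 < c" "\<And>x. norm x \<le> c * norm (blinfun_apply A x)"
proof -
  obtain B where B: "B o\<^sub>L A = id_blinfun"
    using assms by (auto simp: op_invertible_def)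
  have "norm x \<le> (norm B + 1) * norm (blinfun_apply A x)" for x
  proof -
    have "norm x = norm (blinfun_apply B (blinfun_apply A x))"
      using B by (metis blinfun_apply_blinfun_compose blinfun_apply_id_blinfun id_apply)
    also have "\<dots> \<le> norm B * norm (blinfun_apply A x)"
      by (rule norm_blinfun)
    also have "\<dots> \<le> (norm B + 1) * norm (blinfun_apply A x)"
      by (simp add: mult_right_mono)
    finally show ?thesis .
  qed
  then show ?thesis
    using that[of "norm B + 1"] by (simp add: add_nonneg_pos)
qed

text \<open>With \<open>b = norm A\<close>, a sequence of unit vectors along which \<open>norm (A x)\<close> tends to \<open>b\<close> would be
  an approximate eigenvector sequence of \<open>A\<^sup>2 - b\<^sup>2 = (A - b) (A + b)\<close>.\<close>

lemma norm_in_real_spectrum: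
  fixes A :: "'a::complex_hilbert_space \<Rightarrow>\<^sub>L 'a"
  assumes A: "A \<in> herm_ops" and nontriv: "\<not> op_invertible (0 :: 'a \<Rightarrow>\<^sub>L 'a)"
  shows "norm A \<in> real_spectrum A \<or> - norm A \<in> real_spectrum A"
proof (rule ccontr)
  define b where "b = norm A"
  assume "\<not> ?thesis"
  then have inv: "op_invertible (op_poly [:-b, 1:] A)" "op_invertible (op_poly [:b, 1:] A)"
    by (simp_all add: real_spectrum_def b_def op_poly_linear add.commute)
  have "op_invertible (op_poly [:-b, 1:] A o\<^sub>L op_poly [:b, 1:] A)"
    using inv by (rule op_invertible_compose)
  also have "op_poly [:-b, 1:] A o\<^sub>L op_poly [:b, 1:] A = (A o\<^sub>L A) - b\<^sup>2 *\<^sub>R id_blinfun"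
    unfolding op_poly_mult[symmetric] by (simp add: op_poly_pCons power2_eq_square)
  finally obtain c where c: "0 < c"
    "\<And>x. norm x \<le> c * norm (blinfun_apply ((A o\<^sub>L A) - b\<^sup>2 *\<^sub>R id_blinfun) x)"
    using op_invertible_bounded_below by blast
  \<comment> \<open>For b = 0 the operator A would vanish, and the assumed invertibility of A - b
    would be that of the zero operator, which holds only on the trivial space.\<close>
  have b: "0 < b"
    using inv(1) nontriv by (auto simp: b_def op_poly_linear)
  \<comment> \<open>The gap produced by combining the bound \<open>c\<close> below with the estimate
    of (A^2 - b^2) x by b^2 (b^2 |x|^2 - |A x|^2): the norm of A would drop strictly below
    b.\<close>
  define d where "d = 1 / (c\<^sup>2 * b\<^sup>2)"
  have d: "0 < d" using b c by (simp add: d_def)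
  have est: "(norm (blinfun_apply A x))\<^sup>2 \<le> (b\<^sup>2 - d) * (norm x)\<^sup>2" for x
  proof -
    let ?y = "blinfun_apply A x"
    have "(norm (blinfun_apply ((A o\<^sub>L A) - b\<^sup>2 *\<^sub>R id_blinfun) x))\<^sup>2
        = (norm (blinfun_apply A ?y - b\<^sup>2 *\<^sub>R x))\<^sup>2"
      by (simp add: blinfun.diff_left blinfun.scaleR_left)
    also have "\<dots> = (norm (blinfun_apply A ?y))\<^sup>2 - 2 * b\<^sup>2 * rinner (blinfun_apply A ?y) x + b^4 * (norm x)\<^sup>2"
      by (simp add: power2_norm_diff rinner.scaleR_right power_mult_distrib flip: power_mult)
    also have "rinner (blinfun_apply A ?y) x = (norm ?y)\<^sup>2"
      using herm_opsD[OF A, of ?y x] by (simp add: rinner_self)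
    also have "(norm (blinfun_apply A ?y))\<^sup>2 \<le> (b * norm ?y)\<^sup>2"
      using norm_blinfun[of A ?y] by (intro power_mono) (auto simp: b_def)
    finally have *: "(norm (blinfun_apply ((A o\<^sub>L A) - b\<^sup>2 *\<^sub>R id_blinfun) x))\<^sup>2
        \<le> b\<^sup>2 * (b\<^sup>2 * (norm x)\<^sup>2 - (norm ?y)\<^sup>2)"
      by (simp add: algebra_simps power_mult_distrib)
    have "(norm x)\<^sup>2 \<le> (c * norm (blinfun_apply ((A o\<^sub>L A) - b\<^sup>2 *\<^sub>R id_blinfun) x))\<^sup>2"
      using c(2) by (intro power_mono) auto
    also have "\<dots> \<le> c\<^sup>2 * (b\<^sup>2 * (b\<^sup>2 * (norm x)\<^sup>2 - (norm ?y)\<^sup>2))"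
      using * by (simp add: power_mult_distrib mult_left_mono)
    finally have "d * (norm x)\<^sup>2 \<le> b\<^sup>2 * (norm x)\<^sup>2 - (norm ?y)\<^sup>2"
      using b c(1) by (simp add: d_def divide_simps mult_ac)
    then show ?thesis by (simp add: algebra_simps)
  qed
  \<comment> \<open>The maximum keeps the root meaningful, since the sign of b^2 - d is not
    known.\<close>
  define b' where "b' = sqrt (max 0 (b\<^sup>2 - d))"
  have "b' < b"
    unfolding b'_def using b d by (intro real_less_lsqrt) auto
  moreover have "norm (blinfun_apply A x) \<le> b' * norm x" for x
  proof (rule power2_le_imp_le)
    have "(b\<^sup>2 - d) * (norm x)\<^sup>2 \<le> max 0 (b\<^sup>2 - d) * (norm x)\<^sup>2"
      by (intro mult_right_mono) auto
    then show "(norm (blinfun_apply A x))\<^sup>2 \<le> (b' * norm x)\<^sup>2"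
      using est[of x] by (simp add: power_mult_distrib b'_def)
  qed (simp add: b'_def)
  then have "norm A \<le> b'"
    by (intro norm_blinfun_bound) (auto simp: b'_def)
  ultimately show False by (simp add: b_def)
qed

section \<open>Real polynomials, their complex roots, and spectral mapping\<close>

lemma map_poly_of_real_add:
  "map_poly complex_of_real (p + q) = map_poly of_real p + map_poly of_real q"
  by (intro poly_eqI) (simp add: coeff_map_poly)

lemma map_poly_of_real_mult:
  "map_poly complex_of_real (p * q) = map_poly of_real p * map_poly of_real q"
  by (intro poly_eqI) (simp add: coeff_map_poly coeff_mult)

lemma poly_map_poly_of_real:
  "poly (map_poly complex_of_real p) (of_real x) = of_real (poly p x)"
  by (induction p) (simp_all add: map_poly_pCons)

text \<open>The quadratic is (X - z)(X - cnj z). The remainder of p modulo it is real, has degree at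
  most one and vanishes at the non-real z, so it is zero.\<close>

lemma real_quadratic_dvd:
  fixes p :: "real poly"
  assumes "poly (map_poly of_real p) z = 0" "Im z \<noteq> 0"
  shows "[:(Re z)\<^sup>2 + (Im z)\<^sup>2, - 2 * Re z, 1:] dvd p"
proof -
  define q where "q = [:(Re z)\<^sup>2 + (Im z)\<^sup>2, - 2 * Re z, 1:]"
  have q: "poly (map_poly of_real q) z = 0"
    by (simp add: q_def map_poly_pCons complex_eq_iff power2_eq_square algebra_simps)
  have "degree (p mod q) < 2"
    using degree_mod_less[of q p] by (auto simp: q_def)
  then have "degree (p mod q) \<le> 1" by simp
  then obtain a b where ab: "p mod q = [:a, b:]"
    by (metis One_nat_def degree0_coeffs degree1_coeffs le_Suc_eq le_zero_eq pCons_0_0)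
  have "p = p div q * q + [:a, b:]"
    by (metis ab div_mult_mod_eq)
  then have "map_poly of_real p = map_poly of_real (p div q) * map_poly complex_of_real q + map_poly of_real [:a, b:]"
    by (metis map_poly_of_real_mult map_poly_of_real_add)
  then have "poly (map_poly complex_of_real [:a, b:]) z = 0"
    using assms(1) q by simp
  then have "of_real a + z * of_real b = 0"
    by (simp add: map_poly_pCons)
  then have "a = 0" "b = 0"
    using assms(2) by (auto simp: complex_eq_iff)
  then show ?thesis using ab by (simp add: q_def mod_eq_0_iff_dvd)
qed

text \<open>Split off one real factor at a time. A linear factor is invertible because its root is
  not in the spectrum; a quadratic one becomes (A - Re z)^2 + (Im z)^2, which is coercive by
  self-adjointness.\<close>

lemma op_invertible_op_poly:
  fixes A :: "'a::complex_hilbert_space \<Rightarrow>\<^sub>L 'a"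
  assumes A: "A \<in> herm_ops"
  shows "p \<noteq> 0 \<Longrightarrow> (\<And>t. t \<in> real_spectrum A \<Longrightarrow> poly p t \<noteq> 0) \<Longrightarrow> op_invertible (op_poly p A)"
proof (induction "degree p" arbitrary: p rule: less_induct)
  case less
  show ?case
  proof (cases "degree p = 0")
    case True
    then obtain a where a: "p = [:a:]" "a \<noteq> 0"
      using less.prems(1) by (metis pCons_0_0 degree_eq_zeroE)
    have "op_invertible (id_blinfun :: 'a \<Rightarrow>\<^sub>L 'a)"
      by (auto simp: op_invertible_def intro: bounded_ops_id)
    then show ?thesis using a by (simp add: op_poly_const op_invertible_scaleR)
  next
    case False
    then have "\<not> constant (poly (map_poly complex_of_real p))"
      by (simp add: constant_degree degree_map_poly)
    then obtain z where z: "poly (map_poly complex_of_real p) z = 0"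
      using fundamental_theorem_of_algebra by blast
    define q where "q = (if Im z = 0 then [:- Re z, 1:] else [:(Re z)\<^sup>2 + (Im z)\<^sup>2, - 2 * Re z, 1:])"
    have "q dvd p"
    proof (cases "Im z = 0")
      case True
      then have "z = of_real (Re z)" by (simp add: complex_eq_iff)
      then have "poly p (Re z) = 0"
        using z by (metis poly_map_poly_of_real of_real_eq_0_iff)
      then show ?thesis using True by (simp add: q_def poly_eq_0_iff_dvd)
    next
      case False
      then show ?thesis using real_quadratic_dvd[OF z] by (simp add: q_def)
    qed
    then obtain r where r: "p = q * r" by blast
    have "q \<noteq> 0" "0 < degree q" by (auto simp: q_def)
    then have "degree r < degree p"
      using r less.prems(1) by (simp add: degree_mult_eq)
    then have inv_r: "op_invertible (op_poly r A)"
      using less.prems r by (intro less.hyps) auto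
    have "op_invertible (op_poly q A)"
    proof (cases "Im z = 0")
      case True
      have "poly p (Re z) = 0"
        using True by (simp add: r q_def)
      then have "Re z \<notin> real_spectrum A" using less.prems(2) by blast
      then show ?thesis
        using True by (simp add: q_def op_poly_linear real_spectrum_def)
    next
      case False
      define B where "B = op_poly [:- Re z, 1:] A"
      have B: "B \<in> herm_ops" using A by (simp add: B_def op_poly_herm)
      have "[:(Re z)\<^sup>2 + (Im z)\<^sup>2, - 2 * Re z, 1:] = [:- Re z, 1:] * [:- Re z, 1:] + [:(Im z)\<^sup>2:]"
        by (simp add: power2_eq_square)
      then have q: "op_poly q A = (B o\<^sub>L B) + (Im z)\<^sup>2 *\<^sub>R id_blinfun"
        using False by (simp add: q_def op_poly_add op_poly_mult op_poly_const B_def del: mult_pCons_left mult_pCons_right)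
      show ?thesis
      proof (rule coercive_imp_op_invertible)
        show "op_poly q A \<in> bounded_ops"
          using op_poly_herm[OF A] by (rule herm_ops_bounded)
        show "0 < (Im z)\<^sup>2" using False by simp
        show "(Im z)\<^sup>2 * (norm x)\<^sup>2 \<le> rinner x (blinfun_apply (op_poly q A) x)" for x
          using herm_opsD[OF B, of x "blinfun_apply B x"]
          by (simp add: q blinfun.add_left blinfun.scaleR_left rinner.add_right rinner.scaleR_right rinner_self)
      qed
    qed
    then show ?thesis
      using inv_r by (simp add: r op_poly_mult op_invertible_compose)
  qed
qed

text \<open>Some b with |b| equal to the norm of p(A) lies in the spectrum of p(A); then p - b must
  vanish at a spectral point of A, where |p| attains that norm.\<close>

lemma norm_op_poly_le:
  fixes A :: "'a::complex_hilbert_space \<Rightarrow>\<^sub>L 'a"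
  assumes A: "A \<in> herm_ops" and e: "0 \<le> e" "\<And>t. t \<in> real_spectrum A \<Longrightarrow> \<bar>poly p t\<bar> \<le> e"
  shows "norm (op_poly p A) \<le> e"
proof (cases "op_invertible (0 :: 'a \<Rightarrow>\<^sub>L 'a)")
  case True
  \<comment> \<open>On the trivial space the identity is zero, hence every operator is.\<close>
  then have "(id_blinfun :: 'a \<Rightarrow>\<^sub>L 'a) = 0" by (auto simp: op_invertible_def)
  then have "op_poly p A = 0" by (metis blinfun_compose_id(1) blinfun_compose_zero(2))
  then show ?thesis using e by simp
next
  case False
  obtain b where b: "\<bar>b\<bar> = norm (op_poly p A)" "b \<in> real_spectrum (op_poly p A)"
    using norm_in_real_spectrum[OF op_poly_herm[OF A] False, of p]
    by (metis abs_minus_cancel abs_norm_cancel)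
  then have ninv: "\<not> op_invertible (op_poly (p - [:b:]) A)"
    by (simp add: real_spectrum_def op_poly_diff op_poly_const)
  obtain t where "t \<in> real_spectrum A" "poly (p - [:b:]) t = 0"
  proof (cases "p - [:b:] = 0")
    case True
    \<comment> \<open>Here p is the constant b and any spectral point serves; the spectrum is
      nonempty because it contains the norm of A or its negative.\<close>
    then show ?thesis using that norm_in_real_spectrum[OF A False] by auto
  next
    case False
    then show ?thesis using that op_invertible_op_poly[OF A, of "p - [:b:]"] ninv by blast
  qed
  then show ?thesis using e(2)[of t] b(1) by simp
qed

text \<open>X - t divides p - p(t), so if p(A) - p(t) were invertible, its commuting factor A - t
  would be too. This inclusion yields the lower bounds for norms of functions of A.\<close>

lemma real_spectrum_op_poly:
  assumes A: "A \<in> herm_ops" and t: "t \<in> real_spectrum A"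
  shows "poly p t \<in> real_spectrum (op_poly p A)"
proof -
  have "poly (p - [:poly p t:]) t = 0" by simp
  then obtain q where q: "p - [:poly p t:] = [:-t, 1:] * q"
    unfolding poly_eq_0_iff_dvd by blast
  have "op_poly (p - [:poly p t:]) A = op_poly [:-t, 1:] A o\<^sub>L op_poly q A"
    by (simp only: q op_poly_mult)
  moreover have "\<not> op_invertible (op_poly [:-t, 1:] A)"
    using t by (simp add: real_spectrum_def op_poly_linear)
  ultimately have "\<not> op_invertible (op_poly (p - [:poly p t:]) A)"
    using op_invertible_factor op_poly_commute herm_ops_bounded op_poly_herm[OF A] by metis
  then show ?thesis
    by (simp add: real_spectrum_def op_poly_diff op_poly_const)
qed

section \<open>Bounds of the spectrum versus bounds of the quadratic form\<close>

lemma real_spectrum_lower: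
  assumes A: "A \<in> herm_ops" and a: "\<And>x. a * (norm x)\<^sup>2 \<le> rinner x (blinfun_apply A x)"
  shows "real_spectrum A \<subseteq> {a..}"
proof
  fix t assume t: "t \<in> real_spectrum A"
  show "t \<in> {a..}"
  proof (rule ccontr)
    assume "t \<notin> {a..}"
    then have "op_invertible (A - t *\<^sub>R id_blinfun)"
      using a A
      by (intro coercive_imp_op_invertible[where c = "a - t"])
        (auto intro: herm_ops_bounded bounded_ops_intros
          simp: blinfun.diff_left blinfun.scaleR_left rinner.diff_right rinner.scaleR_right rinner_self left_diff_distrib)
    then show False using t by (simp add: real_spectrum_def)
  qed
qed

lemma real_spectrum_upper:
  assumes A: "A \<in> herm_ops" and b: "\<And>x. rinner x (blinfun_apply A x) \<le> b * (norm x)\<^sup>2"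
  shows "real_spectrum A \<subseteq> {..b}"
proof
  fix t assume t: "t \<in> real_spectrum A"
  show "t \<in> {..b}"
  proof (rule ccontr)
    assume "t \<notin> {..b}"
    then have "op_invertible (t *\<^sub>R id_blinfun - A)"
      using b A
      by (intro coercive_imp_op_invertible[where c = "t - b"])
        (auto intro: herm_ops_bounded bounded_ops_intros
          simp: blinfun.diff_left blinfun.scaleR_left rinner.diff_right rinner.scaleR_right rinner_self left_diff_distrib)
    then have "op_invertible (-1 *\<^sub>R (t *\<^sub>R id_blinfun - A))"
      by (rule op_invertible_scaleR) simp
    then show False using t by (simp add: real_spectrum_def)
  qed
qed

text \<open>Centre the interval: on the spectrum |t - m| \<le> (b - a)/2, so the norm of A - m has
  the same bound, and Cauchy-Schwarz carries it to the form.\<close>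

lemma herm_bounds_of_real_spectrum:
  assumes A: "A \<in> herm_ops" and ab: "a \<le> b" "real_spectrum A \<subseteq> {a..b}"
  shows "a * (norm x)\<^sup>2 \<le> rinner x (blinfun_apply A x)"
    and "rinner x (blinfun_apply A x) \<le> b * (norm x)\<^sup>2"
proof -
  define m where "m = (a + b) / 2"
  have "norm (op_poly [:-m, 1:] A) \<le> (b - a) / 2"
    using ab by (intro norm_op_poly_le[OF A]) (auto simp: m_def abs_le_iff field_simps dest!: subsetD)
  then have "norm (blinfun_apply (op_poly [:-m, 1:] A) x) \<le> (b - a) / 2 * norm x"
    by (meson norm_blinfun mult_right_mono norm_ge_zero order_trans)
  then have "norm x * norm (blinfun_apply (op_poly [:-m, 1:] A) x) \<le> norm x * ((b - a) / 2 * norm x)"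
    by (rule mult_left_mono) simp
  then have "\<bar>rinner x (blinfun_apply (op_poly [:-m, 1:] A) x)\<bar> \<le> norm x * ((b - a) / 2 * norm x)"
    using abs_rinner_le_norm order_trans by blast
  moreover have "rinner x (blinfun_apply (op_poly [:-m, 1:] A) x) = rinner x (blinfun_apply A x) - m * (norm x)\<^sup>2"
    by (simp add: op_poly_linear blinfun.add_left blinfun.scaleR_left rinner.add_right
        rinner.scaleR_right rinner_self blinfun.minus_left rinner.minus_right rinner.diff_right blinfun.diff_left)
  ultimately have "\<bar>rinner x (blinfun_apply A x) - m * (norm x)\<^sup>2\<bar> \<le> (b - a) / 2 * (norm x)\<^sup>2"
    by (simp add: power2_eq_square mult_ac)
  then show "a * (norm x)\<^sup>2 \<le> rinner x (blinfun_apply A x)" "rinner x (blinfun_apply A x) \<le> b * (norm x)\<^sup>2"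
    by (auto simp: abs_le_iff m_def field_simps)
qed

subsection \<open>Continuous functional calculus\<close>

text \<open>Two sequences are compared at once: equal ones give the Cauchy property, different ones
  the independence of the limit from the approximation.\<close>

lemma op_poly_eventually_close:
  assumes A: "A \<in> herm_ops" and e: "0 < e"
    and p: "uniform_limit (real_spectrum A) (\<lambda>n. poly (p n)) f sequentially"
    and q: "uniform_limit (real_spectrum A) (\<lambda>n. poly (q n)) f sequentially"
  shows "\<exists>N. \<forall>m\<ge>N. \<forall>n\<ge>N. norm (op_poly (p m) A - op_poly (q n) A) < e"
proof -
  have "\<forall>\<^sub>F n in sequentially. \<forall>t\<in>real_spectrum A. \<bar>poly (p n) t - f t\<bar> < e / 4 \<and> \<bar>poly (q n) t - f t\<bar> < e / 4"
    using uniform_limitD[OF p divide_pos_pos[OF e zero_less_numeral]]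
      uniform_limitD[OF q divide_pos_pos[OF e zero_less_numeral]]
    by eventually_elim (auto simp: dist_real_def)
  then obtain N where N: "\<And>n t. N \<le> n \<Longrightarrow> t \<in> real_spectrum A \<Longrightarrow>
      \<bar>poly (p n) t - f t\<bar> < e / 4 \<and> \<bar>poly (q n) t - f t\<bar> < e / 4"
    unfolding eventually_sequentially by blast
  have "norm (op_poly (p m) A - op_poly (q n) A) < e" if "N \<le> m" "N \<le> n" for m n
  proof -
    have "norm (op_poly (p m - q n) A) \<le> e / 2"
    proof (rule norm_op_poly_le[OF A])
      show "\<bar>poly (p m - q n) t\<bar> \<le> e / 2" if "t \<in> real_spectrum A" for t
        using N[OF \<open>N \<le> m\<close> that] N[OF \<open>N \<le> n\<close> that] unfolding poly_diff by linarith
    qed (use e in simp)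
    then show ?thesis using e by (simp add: op_poly_diff)
  qed
  then show ?thesis by blast
qed

text \<open>This resolves the definite description: the given sequence supplies the limit, all other
  sequences share it, and the given one also forces uniqueness.\<close>

lemma op_fun_tendsto:
  fixes A :: "'a::complex_hilbert_space \<Rightarrow>\<^sub>L 'a"
  assumes A: "A \<in> herm_ops"
    and p: "uniform_limit (real_spectrum A) (\<lambda>n. poly (p n)) f sequentially"
  shows "(\<lambda>n. op_poly (p n) A) \<longlonglongrightarrow> op_fun f A"
proof -
  have "Cauchy (\<lambda>n. op_poly (p n) A)"
  proof (rule CauchyI)
    fix e :: real assume "0 < e"
    then show "\<exists>M. \<forall>m\<ge>M. \<forall>n\<ge>M. norm (op_poly (p m) A - op_poly (p n) A) < e"
      using A p by (intro op_poly_eventually_close)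
  qed
  then obtain B where B: "(\<lambda>n. op_poly (p n) A) \<longlonglongrightarrow> B"
    using Cauchy_convergent convergent_def by blast
  have lim: "(\<lambda>n. op_poly (q n) A) \<longlonglongrightarrow> B"
    if q: "uniform_limit (real_spectrum A) (\<lambda>n. poly (q n)) f sequentially" for q
  proof -
    have "(\<lambda>n. op_poly (p n) A - op_poly (q n) A) \<longlonglongrightarrow> 0"
    proof (rule LIMSEQ_I)
      fix e :: real assume e: "0 < e"
      show "\<exists>no. \<forall>n\<ge>no. norm (op_poly (p n) A - op_poly (q n) A - 0) < e"
        using op_poly_eventually_close[OF A e p q] by auto
    qed
    from tendsto_diff[OF B this] show ?thesis by simp
  qed
  have "op_fun f A = B"
    unfolding op_fun_def real_spectrum_eq
    using lim p by (intro the_equality) (auto intro: LIMSEQ_unique)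
  then show ?thesis using B by simp
qed

lemma poly_uniform_approximation:
  fixes f :: "real \<Rightarrow> real"
  assumes "compact S" "continuous_on S f"
  obtains p where "uniform_limit S (\<lambda>n. poly (p n)) f sequentially"
proof -
  have "\<exists>q. \<forall>t\<in>S. \<bar>f t - poly q t\<bar> < inverse (Suc n)" for n
  proof -
    obtain g where g: "real_polynomial_function g" "\<And>t. t \<in> S \<Longrightarrow> \<bar>f t - g t\<bar> < inverse (Suc n)"
      using Stone_Weierstrass_real_polynomial_function[OF assms, of "inverse (Suc n)"] by auto
    from g(1) obtain a k where "g = (\<lambda>t. \<Sum>i\<le>k. a i * t ^ i)"
      unfolding real_polynomial_function_iff_sum by blast
    then have "g t = poly (\<Sum>i\<le>k. monom (a i) i) t" for t
      by (simp add: poly_sum poly_monom)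
    then show ?thesis using g(2) by (intro exI[of _ "\<Sum>i\<le>k. monom (a i) i"]) simp
  qed
  then obtain p where p: "\<And>n t. t \<in> S \<Longrightarrow> \<bar>f t - poly (p n) t\<bar> < inverse (Suc n)" by metis
  have "uniform_limit S (\<lambda>n. poly (p n)) f sequentially"
  proof (rule uniform_limitI)
    fix e :: real assume "0 < e"
    then have "\<forall>\<^sub>F n in sequentially. inverse (real (Suc n)) < e"
      using LIMSEQ_inverse_real_of_nat by (rule order_tendstoD(2)[rotated])
    then show "\<forall>\<^sub>F n in sequentially. \<forall>t\<in>S. dist (poly (p n) t) (f t) < e"
    proof eventually_elim
      case (elim n)
      then show ?case using p less_trans by (fastforce simp: dist_real_def abs_minus_commute)
    qed
  qed
  then show ?thesis by (rule that)
qed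

lemma abs_real_spectrum_le_norm:
  assumes A: "A \<in> herm_ops" and t: "t \<in> real_spectrum A"
  shows "\<bar>t\<bar> \<le> norm A"
proof -
  have "rinner x (blinfun_apply A x) \<le> norm A * (norm x)\<^sup>2"
    "- norm A * (norm x)\<^sup>2 \<le> rinner x (blinfun_apply A x)" for x
    using abs_rinner_blinfun_le[of x A] by (auto simp: abs_le_iff)
  then have "real_spectrum A \<subseteq> {- norm A..} \<and> real_spectrum A \<subseteq> {..norm A}"
    by (intro conjI real_spectrum_lower[OF A] real_spectrum_upper[OF A])
  then have "- norm A \<le> t" "t \<le> norm A" using t by blast+
  then show ?thesis by simp
qed

text \<open>The set \<open>S\<close> is where Weierstrass approximation takes place, in practice an
  interval around the spectrum. The bound holds for each polynomial by spectral mapping and passes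
  to the limit.\<close>

lemma abs_le_norm_op_fun:
  assumes A: "A \<in> herm_ops" and S: "compact S" "continuous_on S f" "real_spectrum A \<subseteq> S"
    and t: "t \<in> real_spectrum A"
  shows "\<bar>f t\<bar> \<le> norm (op_fun f A)"
proof -
  obtain p where "uniform_limit S (\<lambda>n. poly (p n)) f sequentially"
    using poly_uniform_approximation[OF S(1,2)] .
  then have p: "uniform_limit (real_spectrum A) (\<lambda>n. poly (p n)) f sequentially"
    using S(3) by (rule uniform_limit_on_subset)
  show ?thesis
  proof (rule tendsto_le[OF sequentially_bot])
    show "(\<lambda>n. norm (op_poly (p n) A)) \<longlonglongrightarrow> norm (op_fun f A)"
      by (intro tendsto_norm op_fun_tendsto A p)
    show "(\<lambda>n. \<bar>poly (p n) t\<bar>) \<longlonglongrightarrow> \<bar>f t\<bar>"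
      by (intro tendsto_rabs tendsto_uniform_limitI[OF p t])
    show "\<forall>\<^sub>F n in sequentially. \<bar>poly (p n) t\<bar> \<le> norm (op_poly (p n) A)"
      using A t by (simp add: abs_real_spectrum_le_norm op_poly_herm real_spectrum_op_poly)
  qed
qed

lemma norm_op_fun_le:
  assumes A: "A \<in> herm_ops" and S: "compact S" "continuous_on S f" "real_spectrum A \<subseteq> S"
    and e: "0 \<le> e" "\<And>t. t \<in> real_spectrum A \<Longrightarrow> \<bar>f t\<bar> \<le> e"
  shows "norm (op_fun f A) \<le> e"
proof -
  obtain p where "uniform_limit S (\<lambda>n. poly (p n)) f sequentially"
    using poly_uniform_approximation[OF S(1,2)] .
  then have p: "uniform_limit (real_spectrum A) (\<lambda>n. poly (p n)) f sequentially"
    using S(3) by (rule uniform_limit_on_subset)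
  show ?thesis
  proof (rule field_le_epsilon)
    fix d :: real assume d: "0 < d"
    have "\<forall>\<^sub>F n in sequentially. norm (op_poly (p n) A) \<le> e + d"
      using uniform_limitD[OF p d]
    proof eventually_elim
      case (elim n)
      then show ?case
        using d e by (intro norm_op_poly_le[OF A]) (force simp: dist_real_def)+
    qed
    then show "norm (op_fun f A) \<le> e + d"
      by (intro tendsto_upperbound[OF tendsto_norm[OF op_fun_tendsto[OF A p]]]) auto
  qed
qed

text \<open>Complex linearity and symmetry are both identities between numbers
  \<open>rinner v (X w)\<close>, once the scalar c has been moved to the left argument as
  \<open>cnj c\<close>.\<close>

lemma herm_ops_weak_limit:
  fixes X :: "'i \<Rightarrow> 'a::complex_hilbert_space \<Rightarrow>\<^sub>L 'a"
  assumes F: "F \<noteq> bot" and X: "\<forall>\<^sub>F i in F. X i \<in> herm_ops"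
    and lim: "\<And>v w. ((\<lambda>i. rinner v (blinfun_apply (X i) w)) \<longlongrightarrow> rinner v (blinfun_apply B w)) F"
  shows "B \<in> herm_ops"
proof -
  have "blinfun_apply B (c *\<^sub>C x) = c *\<^sub>C blinfun_apply B x" for c x
  proof (rule rinner_eqI)
    fix v
    have "\<forall>\<^sub>F i in F. rinner v (blinfun_apply (X i) (c *\<^sub>C x)) = rinner (cnj c *\<^sub>C v) (blinfun_apply (X i) x)"
      using X by eventually_elim (simp add: herm_ops_bounded bounded_opsD rinner_scaleC_right)
    then have "((\<lambda>i. rinner (cnj c *\<^sub>C v) (blinfun_apply (X i) x)) \<longlongrightarrow> rinner v (blinfun_apply B (c *\<^sub>C x))) F"
      using lim by (rule Lim_transform_eventually[rotated])
    then have "rinner v (blinfun_apply B (c *\<^sub>C x)) = rinner (cnj c *\<^sub>C v) (blinfun_apply B x)"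
      using lim F tendsto_unique by blast
    then show "rinner v (blinfun_apply B (c *\<^sub>C x)) = rinner v (c *\<^sub>C blinfun_apply B x)"
      by (simp add: rinner_scaleC_right)
  qed
  moreover have "rinner v (blinfun_apply B w) = rinner (blinfun_apply B v) w" for v w
  proof -
    have "\<forall>\<^sub>F i in F. rinner v (blinfun_apply (X i) w) = rinner w (blinfun_apply (X i) v)"
      using X by eventually_elim (metis herm_opsD rinner_commute)
    then have "((\<lambda>i. rinner w (blinfun_apply (X i) v)) \<longlongrightarrow> rinner v (blinfun_apply B w)) F"
      using lim by (rule Lim_transform_eventually[rotated])
    then have "rinner v (blinfun_apply B w) = rinner w (blinfun_apply B v)"
      using lim F tendsto_unique by blast
    then show ?thesis by (simp add: rinner_commute)
  qed
  ultimately show ?thesis by (simp add: herm_ops_def bounded_ops_def)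
qed

lemma herm_ops_LIMSEQ:
  assumes "\<And>n. X n \<in> herm_ops" "X \<longlonglongrightarrow> B"
  shows "B \<in> herm_ops"
  using assms by (intro herm_ops_weak_limit[of sequentially X])
    (auto intro!: rinner.tendsto tendsto_const blinfun.tendsto)

text \<open>With polynomials p tending to f(t) = t^(-1/2), the products p(t) t p(t) tend uniformly
  to 1. The operators p(x) x p(x) therefore converge both to s x s and to the identity.\<close>

lemma inverse_sqrt_op:
  assumes x: "x \<in> herm_ops" and a: "0 < a" "\<And>v. a * (norm v)\<^sup>2 \<le> rinner v (blinfun_apply x v)"
  defines "s \<equiv> op_fun (\<lambda>t. t powr (-1/2)) x"
  shows "s \<in> herm_ops" and "s o\<^sub>L (x o\<^sub>L s) = id_blinfun"
proof -
  define f where "f = (\<lambda>t::real. t powr (-1/2))"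
  \<comment> \<open>The left end a > 0 keeps the interval away from the singularity of f at
    0.\<close>
  define S where "S = {a..norm x}"
  have S: "real_spectrum x \<subseteq> S"
    using real_spectrum_lower[OF x a(2)] abs_real_spectrum_le_norm[OF x] by (fastforce simp: S_def)
  have cont: "continuous_on S f"
    using a(1) by (auto simp: f_def S_def intro!: continuous_intros)
  then obtain p where pS: "uniform_limit S (\<lambda>n. poly (p n)) f sequentially"
    using poly_uniform_approximation[of S f] by (auto simp: S_def)
  have lim: "(\<lambda>n. op_poly (p n) x) \<longlonglongrightarrow> s"
    unfolding s_def f_def[symmetric]
    using x uniform_limit_on_subset[OF pS S] by (rule op_fun_tendsto)
  then show "s \<in> herm_ops"
    using x by (auto intro: herm_ops_LIMSEQ op_poly_herm)
  have bdd: "bounded (f ` S)" "bounded ((\<lambda>t. t) ` S)" "bounded ((\<lambda>t. t * f t) ` S)"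
    by (intro compact_imp_bounded compact_continuous_image continuous_intros cont; simp add: S_def)+
  have "uniform_limit S (\<lambda>n t. poly (p n) t * (t * poly (p n) t)) (\<lambda>t. f t * (t * f t)) sequentially"
    by (intro uniform_lim_mult pS uniform_limit_const bdd)
  moreover have "f t * (t * f t) = 1" if "t \<in> S" for t
  proof -
    have "0 < t" using that a(1) by (simp add: S_def)
    then have "f t * (t * f t) = t powr (-1/2) * (t powr 1 * t powr (-1/2))"
      by (simp add: f_def)
    also have "\<dots> = 1"
      unfolding powr_add[symmetric] using \<open>0 < t\<close> by simp
    finally show ?thesis .
  qed
  ultimately have "uniform_limit S (\<lambda>n. poly (p n * ([:0, 1:] * p n))) (\<lambda>t. 1) sequentially"
    by (simp add: mult_ac cong: uniform_limit_cong')
  then have "(\<lambda>n. op_poly (p n * ([:0, 1:] * p n)) x) \<longlonglongrightarrow> op_fun (\<lambda>t. 1) x"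
    by (intro op_fun_tendsto x uniform_limit_on_subset[OF _ S])
  moreover have "(\<lambda>n. op_poly (p n * ([:0, 1:] * p n)) x) \<longlonglongrightarrow> (s o\<^sub>L (x o\<^sub>L s))"
    unfolding op_poly_mult op_poly_linear
    by (simp, intro bounded_bilinear.tendsto[OF bounded_bilinear_blinfun_compose] lim tendsto_const)
  moreover have "(\<lambda>n. op_poly [:1:] x) \<longlonglongrightarrow> op_fun (\<lambda>t. 1) x"
    by (rule op_fun_tendsto[OF x]) (simp add: uniform_limit_iff)
  ultimately show "s o\<^sub>L (x o\<^sub>L s) = id_blinfun"
    by (simp add: op_poly_const) (metis LIMSEQ_unique tendsto_const)
qed

subsection \<open>The Thompson metric and the order of quadratic forms\<close>

text \<open>Polarization: at v + iw the imaginary part of the form reduces to Re(v, A w) - Re(w, A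
  v), and positivity makes it zero.\<close>

lemma op_positive_herm:
  assumes A: "A \<in> bounded_ops" and pos: "op_positive A"
  shows "A \<in> herm_ops"
proof -
  have "rinner v (blinfun_apply A w) = rinner (blinfun_apply A v) w" for v w
  proof -
    have im: "Im (cinner u (blinfun_apply A u)) = 0" for u
      using pos by (auto simp: op_positive_def complex_nonneg_Reals_iff)
    have add_left: "cinner (u + u') u'' = cinner u u'' + cinner u' u''" for u u' u'' :: 'a
      by (metis cinner_add_right cinner_commute complex_cnj_add)
    have "Im (cinner (v + \<i> *\<^sub>C w) (blinfun_apply A (v + \<i> *\<^sub>C w))) = 0" by (rule im)
    then have "Re (cinner v (blinfun_apply A w)) - Re (cinner w (blinfun_apply A v)) = 0"
      using im[of v] im[of w]
      by (simp add: blinfun.add_right bounded_opsD[OF A] add_left cinner_add_right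
          cinner_scaleC_right cinner_scaleC_left)
    then show ?thesis using rinner_commute[of w "blinfun_apply A v"] by (simp add: rinner_def)
  qed
  then show ?thesis using A by (simp add: herm_ops_def)
qed

text \<open>Positivity of the form at v - (1/m) A v, expanded, gives |A v|^2 / m \<le> (v, A v);
  invertibility bounds |A v| below by |v| / k. Hence the constant 1/(k^2 m).\<close>

lemma pos_inv_ops_coercive:
  fixes A :: "'a::complex_hilbert_space \<Rightarrow>\<^sub>L 'a"
  assumes "A \<in> pos_inv_ops"
  obtains c where "A \<in> herm_ops" "0 < c" "\<And>v. c * (norm v)\<^sup>2 \<le> rinner v (blinfun_apply A v)"
proof -
  have A: "A \<in> herm_ops" "op_positive A" "op_invertible A"
    using assms op_positive_herm by (auto simp: pos_inv_ops_def)
  have pos: "0 \<le> rinner v (blinfun_apply A v)" for v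
    using A(2) by (auto simp: op_positive_def complex_nonneg_Reals_iff rinner_def)
  obtain k where k: "0 < k" "\<And>v. norm v \<le> k * norm (blinfun_apply A v)"
    using op_invertible_bounded_below[OF A(3)] by blast
  define m where "m = norm A + 1"
  have m: "0 < m" "norm A \<le> m" by (auto simp: m_def add_nonneg_pos)
  have "1 / (k\<^sup>2 * m) * (norm v)\<^sup>2 \<le> rinner v (blinfun_apply A v)" for v
  proof -
    define w where "w = blinfun_apply A v"
    have "rinner w (blinfun_apply A w) \<le> m * (norm w)\<^sup>2"
      using abs_rinner_blinfun_le[of w A] mult_right_mono[OF m(2), of "(norm w)\<^sup>2"] by simp
    then have "1 / m * (1 / m * rinner w (blinfun_apply A w)) \<le> 1 / m * (norm w)\<^sup>2"
      using m by (intro mult_left_mono) (auto simp: divide_simps mult_ac)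
    moreover have "rinner (v - (1 / m) *\<^sub>R w) (blinfun_apply A (v - (1 / m) *\<^sub>R w))
        = rinner v w - 2 * (1 / m * (norm w)\<^sup>2) + 1 / m * (1 / m * rinner w (blinfun_apply A w))"
      using herm_opsD[OF A(1), of v w]
      by (simp add: blinfun.diff_right blinfun.scaleR_right rinner.diff_left rinner.diff_right
          rinner.scaleR_left rinner.scaleR_right w_def[symmetric] rinner_self right_diff_distrib)
    ultimately have "1 / m * (norm w)\<^sup>2 \<le> rinner v w"
      using pos[of "v - (1 / m) *\<^sub>R w"] by linarith
    have "(norm v)\<^sup>2 \<le> k\<^sup>2 * (norm w)\<^sup>2"
      using power_mono[OF k(2)[of v] norm_ge_zero, of 2] by (simp add: w_def power_mult_distrib)
    then have "1 / (k\<^sup>2 * m) * (norm v)\<^sup>2 \<le> 1 / (k\<^sup>2 * m) * (k\<^sup>2 * (norm w)\<^sup>2)"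
      using m(1) by (intro mult_left_mono) auto
    then show ?thesis using k(1) \<open>1 / m * (norm w)\<^sup>2 \<le> rinner v w\<close> by (simp add: w_def)
  qed
  then show ?thesis using that[OF A(1), of "1 / (k\<^sup>2 * m)"] k(1) m(1) by simp
qed

lemma pos_inv_opsI:
  assumes A: "A \<in> herm_ops" and c: "0 < c" "\<And>v. c * (norm v)\<^sup>2 \<le> rinner v (blinfun_apply A v)"
  shows "A \<in> pos_inv_ops"
proof -
  have "cinner v (blinfun_apply A v) = complex_of_real (rinner v (blinfun_apply A v))" for v
  proof -
    \<comment> \<open>Multiplication by \<i> exposes the imaginary part of the inner product to the
      real symmetry relation.\<close>
    have "rinner v (blinfun_apply A (\<i> *\<^sub>C v)) = rinner (blinfun_apply A v) (\<i> *\<^sub>C v)"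
      by (rule herm_opsD[OF A])
    then have "Im (cinner v (blinfun_apply A v)) = Im (cinner (blinfun_apply A v) v)"
      using A by (simp add: herm_ops_bounded bounded_opsD rinner_def cinner_scaleC_right)
    also have "\<dots> = - Im (cinner v (blinfun_apply A v))"
      by (metis cinner_commute complex_cnj complex.sel(2) complex.collapse)
    finally show ?thesis by (simp add: complex_eq_iff rinner_def)
  qed
  moreover have "0 \<le> rinner v (blinfun_apply A v)" for v
    using c(1) c(2)[of v] by (meson mult_nonneg_nonneg less_imp_le zero_le_power2 order_trans)
  ultimately have "op_positive A"
    by (simp add: op_positive_def complex_nonneg_Reals_iff)
  then show ?thesis
    using coercive_imp_op_invertible[OF herm_ops_bounded[OF A] c] A
    by (simp add: pos_inv_ops_def herm_ops_bounded)
qed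

text \<open>Substituting s v for v, with s = x^(-1/2), turns the form of x into the squared norm and
  the form of y into that of z = s y s. The logarithm bound says that the spectrum of z lies between
  exp(-r) and exp(r).\<close>

lemma thompson_dist_le_iff:
  fixes x y :: "'a::complex_hilbert_space \<Rightarrow>\<^sub>L 'a"
  assumes x: "x \<in> pos_inv_ops" and y: "y \<in> pos_inv_ops" and r: "0 \<le> r"
  shows "thompson_dist x y \<le> r \<longleftrightarrow>
    (\<forall>v. exp (- r) * rinner v (blinfun_apply x v) \<le> rinner v (blinfun_apply y v) \<and>
         rinner v (blinfun_apply y v) \<le> exp r * rinner v (blinfun_apply x v))"
proof -
  obtain a where xh: "x \<in> herm_ops" and a: "0 < a" "\<And>v. a * (norm v)\<^sup>2 \<le> rinner v (blinfun_apply x v)"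
    using pos_inv_ops_coercive[OF x] by blast
  obtain c where yh: "y \<in> herm_ops" and c: "0 < c" "\<And>v. c * (norm v)\<^sup>2 \<le> rinner v (blinfun_apply y v)"
    using pos_inv_ops_coercive[OF y] by blast
  define s where "s = op_fun (\<lambda>t. t powr (-1/2)) x"
  have s: "s \<in> herm_ops" "s o\<^sub>L (x o\<^sub>L s) = id_blinfun"
    unfolding s_def using inverse_sqrt_op[OF xh a] by simp_all
  have sxs: "blinfun_apply s (blinfun_apply x (blinfun_apply s v)) = v" for v
    using s(2) by (metis blinfun_apply_blinfun_compose blinfun_apply_id_blinfun id_apply)
  define z where "z = s o\<^sub>L y o\<^sub>L s"
  have zh: "z \<in> herm_ops"
    using s(1) yh by (simp add: z_def herm_ops_def bounded_ops_compose)
  have qz: "rinner v (blinfun_apply z v) = rinner (blinfun_apply s v) (blinfun_apply y (blinfun_apply s v))" for v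
    using herm_opsD[OF s(1)] by (simp add: z_def)
  have qx: "(norm v)\<^sup>2 = rinner (blinfun_apply s v) (blinfun_apply x (blinfun_apply s v))" for v
    by (metis herm_opsD[OF s(1)] sxs rinner_self)
  \<comment> \<open>A positive lower bound of z confines its spectrum to an interval on which ln is
    continuous; it comes from |v|^2 = (s v, x s v) \<le> (|x| + 1) |s v|^2.\<close>
  have lower: "c / (norm x + 1) * (norm v)\<^sup>2 \<le> rinner v (blinfun_apply z v)" for v
  proof -
    let ?u = "blinfun_apply s v"
    have "(norm v)\<^sup>2 \<le> norm ?u * norm (blinfun_apply x ?u)"
      unfolding qx by (rule rinner_le_norm)
    also have "\<dots> \<le> norm ?u * ((norm x + 1) * norm ?u)"
    proof (intro mult_left_mono)
      show "norm (blinfun_apply x ?u) \<le> (norm x + 1) * norm ?u"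
        using norm_blinfun[of x ?u] norm_ge_zero[of ?u] unfolding distrib_right by linarith
    qed simp
    finally have "(norm v)\<^sup>2 / (norm x + 1) \<le> (norm ?u)\<^sup>2"
      by (simp add: divide_simps add_nonneg_pos power2_eq_square mult_ac)
    then have "c * ((norm v)\<^sup>2 / (norm x + 1)) \<le> c * (norm ?u)\<^sup>2"
      using c(1) by (intro mult_left_mono) auto
    then show ?thesis using c(2)[of ?u] by (simp add: qz)
  qed
  define a' where "a' = c / (norm x + 1)"
  have a': "0 < a'" using c(1) by (simp add: a'_def add_nonneg_pos)
  have S: "compact {a'..norm z}" "continuous_on {a'..norm z} ln" "real_spectrum z \<subseteq> {a'..norm z}"
    using a' real_spectrum_lower[OF zh, of a'] lower abs_real_spectrum_le_norm[OF zh]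
    by (auto simp: a'_def intro!: continuous_intros) fastforce+
  have ln_iff: "\<bar>ln t\<bar> \<le> r \<longleftrightarrow> t \<in> {exp (- r)..exp r}" if "t \<in> real_spectrum z" for t
  proof -
    have "0 < t" using that S(3) a' by fastforce
    then obtain u where "t = exp u" by (metis exp_ln)
    then show ?thesis by auto
  qed
  have "thompson_dist x y \<le> r \<longleftrightarrow> norm (op_fun ln z) \<le> r"
    by (simp add: thompson_dist_def s_def z_def Let_def)
  also have "\<dots> \<longleftrightarrow> (\<forall>t\<in>real_spectrum z. \<bar>ln t\<bar> \<le> r)"
    using abs_le_norm_op_fun[OF zh S] norm_op_fun_le[OF zh S r] by (meson order_trans)
  also have "\<dots> \<longleftrightarrow> real_spectrum z \<subseteq> {exp (- r)..exp r}"
    using ln_iff by blast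
  also have "\<dots> \<longleftrightarrow> (\<forall>v. exp (- r) * (norm v)\<^sup>2 \<le> rinner v (blinfun_apply z v) \<and>
      rinner v (blinfun_apply z v) \<le> exp r * (norm v)\<^sup>2)"
    (is "_ \<longleftrightarrow> ?bounds")
  proof
    assume "real_spectrum z \<subseteq> {exp (- r)..exp r}"
    then show ?bounds
      using herm_bounds_of_real_spectrum[OF zh, of "exp (- r)" "exp r"] r by simp
  next
    assume ?bounds
    then have "real_spectrum z \<subseteq> {exp (- r)..}" "real_spectrum z \<subseteq> {..exp r}"
      by (blast intro!: real_spectrum_lower[OF zh] real_spectrum_upper[OF zh])+
    then show "real_spectrum z \<subseteq> {exp (- r)..exp r}" by fastforce
  qed
  also have "\<dots> \<longleftrightarrow> (\<forall>v. exp (- r) * rinner v (blinfun_apply x v) \<le> rinner v (blinfun_apply y v) \<and>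
         rinner v (blinfun_apply y v) \<le> exp r * rinner v (blinfun_apply x v))"
    (is "_ \<longleftrightarrow> (\<forall>v. ?P v)")
  proof
    assume *: "\<forall>v. exp (- r) * (norm v)\<^sup>2 \<le> rinner v (blinfun_apply z v) \<and>
      rinner v (blinfun_apply z v) \<le> exp r * (norm v)\<^sup>2"
    \<comment> \<open>The preimage of v is x (s v).\<close>
    have surj: "\<exists>w. v = blinfun_apply s w" for v
      by (metis sxs)
    show "\<forall>v. ?P v" by (metis * qx qz surj)
  next
    assume "\<forall>v. ?P v"
    then show "\<forall>v. exp (- r) * (norm v)\<^sup>2 \<le> rinner v (blinfun_apply z v) \<and>
      rinner v (blinfun_apply z v) \<le> exp r * (norm v)\<^sup>2"
      unfolding qz qx by blast
  qed
  finally show ?thesis .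
qed

subsection \<open>Weak operator compactness and midpoints\<close>

text \<open>The representing vector minimises |v|^2 - 2 f(v); minimising sequences are Cauchy by the
  parallelogram law, and completeness supplies the minimiser.\<close>

lemma riesz_representation:
  fixes f :: "'a::complex_hilbert_space \<Rightarrow> real"
  assumes f: "bounded_linear f"
  obtains z where "\<And>v. f v = rinner z v"
proof -
  interpret f: bounded_linear f by (rule f)
  obtain K where K: "\<And>v. norm (f v) \<le> norm v * K" using f.bounded by blast
  define J where "J v = (norm v)\<^sup>2 - 2 * f v" for v
  have "- (K\<^sup>2) \<le> J v" for v
  proof -
    have "f v \<le> norm v * K" using K[of v] by simp
    moreover have "0 \<le> (norm v - K)\<^sup>2" by simp
    ultimately show ?thesis unfolding power2_diff J_def by linarith
  qed
  then have bdd: "bdd_below (range J)" by (auto simp: bdd_below_def)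
  define m where "m = Inf (range J)"
  have m: "m \<le> J v" for v unfolding m_def using bdd by (simp add: cInf_lower)
  have "\<exists>v. J v < m + inverse (Suc n)" for n
    using cInf_lessD[of "range J" "m + inverse (Suc n)"] by (auto simp: m_def)
  then obtain v where v: "\<And>n. J (v n) < m + inverse (Suc n)" by metis
  have dist_le: "(norm (x - y))\<^sup>2 \<le> 2 * (J x + J y - 2 * m)" for x y
  proof -
    have "4 * (norm ((1 / 2) *\<^sub>R (x + y)))\<^sup>2 = (norm (x + y))\<^sup>2"
      by (simp add: power_divide)
    then have "4 * J ((1 / 2) *\<^sub>R (x + y)) = (norm (x + y))\<^sup>2 - 4 * f x - 4 * f y"
      by (simp add: J_def f.scaleR f.add field_simps)
    with m[of "(1 / 2) *\<^sub>R (x + y)"] show ?thesis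
      by (simp add: J_def power2_norm_add power2_norm_diff)
  qed
  have "Cauchy v"
  proof (rule CauchyI)
    fix e :: real assume e: "0 < e"
    then obtain N where N: "inverse (real (Suc N)) < e\<^sup>2 / 4"
      using reals_Archimedean[of "e\<^sup>2 / 4"] by auto
    have small: "J (v i) < m + e\<^sup>2 / 4" if "N \<le> i" for i
    proof -
      have "inverse (real (Suc i)) \<le> inverse (real (Suc N))"
        using that by (simp add: le_imp_inverse_le)
      also note N
      finally show ?thesis by (intro less_trans[OF v] add_strict_left_mono)
    qed
    have "norm (v i - v j) < e" if "N \<le> i" "N \<le> j" for i j
    proof (rule power2_less_imp_less)
      show "(norm (v i - v j))\<^sup>2 < e\<^sup>2"
        using dist_le[of "v i" "v j"] small[OF that(1)] small[OF that(2)] by (simp add: field_simps)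
    qed (use e in simp)
    then show "\<exists>M. \<forall>i\<ge>M. \<forall>j\<ge>M. norm (v i - v j) < e" by blast
  qed
  then obtain z where z: "v \<longlonglongrightarrow> z"
    using Cauchy_convergent convergent_def by blast
  have "(\<lambda>n. J (v n)) \<longlonglongrightarrow> J z"
    unfolding J_def by (intro tendsto_intros z f.tendsto)
  moreover have "(\<lambda>n. m + inverse (real (Suc n))) \<longlonglongrightarrow> m + 0"
    by (intro tendsto_intros LIMSEQ_inverse_real_of_nat)
  ultimately have "J z \<le> m + 0"
    using v by (intro LIMSEQ_le) (auto intro: less_imp_le)
  then have min: "J z \<le> J w" for w using m[of w] by simp
  have "f x = rinner z x" for x
  proof (cases "x = 0")
    case False
    define g where "g = rinner z x - f x"
    \<comment> \<open>The optimal step along x: it changes J by exactly t g = -g^2 / |x|^2, so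
      minimality forces g = 0.\<close>
    define t where "t = - g / (norm x)\<^sup>2"
    have t: "t * (norm x)\<^sup>2 = - g" using False by (simp add: t_def)
    have "J (z + t *\<^sub>R x) = J z + 2 * t * g + t * (t * (norm x)\<^sup>2)"
      unfolding J_def power2_norm_add f.add f.scaleR rinner.scaleR_right g_def norm_scaleR
      by (simp add: power_mult_distrib algebra_simps) (simp add: power2_eq_square)
    then have "0 \<le> t * g" using min[of "z + t *\<^sub>R x"] unfolding t by (simp add: mult.commute)
    then have "g = 0" using False by (auto simp: t_def divide_simps mult_le_0_iff zero_le_mult_iff)
    then show ?thesis by (simp add: g_def)
  qed (simp add: rinner.zero_right)
  then show ?thesis by (rule that)
qed

text \<open>Banach-Alaoglu through Tychonoff: an operator is viewed as the family of its values (v,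
  X w), each confined to a compact interval. The limit family is bilinear and bounded, and Riesz
  turns it into an operator.\<close>

lemma weak_operator_cluster_point:
  fixes X :: "'i \<Rightarrow> 'a::complex_hilbert_space \<Rightarrow>\<^sub>L 'a"
  assumes F: "F \<noteq> bot" and C: "\<And>i. norm (X i) \<le> C"
  obtains G B where "G \<noteq> bot" "G \<le> F"
    "\<And>v w. ((\<lambda>i. rinner v (blinfun_apply (X i) w)) \<longlongrightarrow> rinner v (blinfun_apply B w)) G"
proof -
  define e where "e i = (\<lambda>(v, w). rinner v (blinfun_apply (X i) w))" for i
  define D where "D = (\<lambda>(v::'a, w::'a). {- (norm v * (C * norm w))..norm v * (C * norm w)})"
  define K where "K = (\<Pi>\<^sub>E p\<in>UNIV. D p)"
  have bound: "\<bar>rinner v (blinfun_apply (X i) w)\<bar> \<le> norm v * (C * norm w)" for v w i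
  proof -
    have "norm (blinfun_apply (X i) w) \<le> C * norm w"
      using norm_blinfun C by (meson mult_right_mono norm_ge_zero order_trans)
    then show ?thesis
      using abs_rinner_le_norm by (meson mult_left_mono norm_ge_zero order_trans)
  qed
  have "compactin (product_topology (\<lambda>_. euclidean) UNIV) K"
    unfolding K_def compactin_PiE by (auto simp: compactin_euclidean_iff D_def)
  then have "compact K"
    by (simp add: euclidean_product_topology compactin_euclidean_iff)
  moreover have "\<forall>\<^sub>F y in filtermap e F. y \<in> K"
    using bound by (auto simp: eventually_filtermap K_def D_def e_def abs_le_iff minus_le_iff intro!: always_eventually)
  ultimately obtain b where b: "b \<in> K" "inf (nhds b) (filtermap e F) \<noteq> bot"
    using F by (metis compact_filter filtermap_bot_iff)
  \<comment> \<open>The filter form of a subnet: along it \<open>e\<close> converges to the cluster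
    point b.\<close>
  define G where "G = inf (filtercomap e (nhds b)) F"
  have G: "G \<noteq> bot" "G \<le> F"
  proof -
    have "inf (nhds b) (filtermap e F) = bot" if "G = bot"
    proof -
      have "eventually (\<lambda>_. False) G" using that by simp
      then obtain P Q where PQ: "eventually P (nhds b)" "eventually Q F" "\<And>i. \<not> (P (e i) \<and> Q i)"
        unfolding G_def eventually_inf eventually_filtercomap by blast
      have "eventually (\<lambda>y. \<not> P y) (filtermap e F)"
        unfolding eventually_filtermap using PQ(2) by eventually_elim (use PQ(3) in blast)
      then have "eventually (\<lambda>_. False) (inf (nhds b) (filtermap e F))"
        unfolding eventually_inf using PQ(1) by blast
      then show ?thesis by (simp add: trivial_limit_def)
    qed
    then show "G \<noteq> bot" using b(2) by blast
    show "G \<le> F" by (simp add: G_def)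
  qed
  have "filterlim e (nhds b) G"
    unfolding G_def filterlim_iff_le_filtercomap by simp
  then have "((\<lambda>i. e i (v, w)) \<longlongrightarrow> b (v, w)) G" for v w
    by (rule continuous_on_tendsto_compose[OF continuous_on_product_coordinates]) simp_all
  then have lim: "((\<lambda>i. rinner v (blinfun_apply (X i) w)) \<longlongrightarrow> b (v, w)) G" for v w
    by (simp add: e_def)
  have b_bound: "\<bar>b (v, w)\<bar> \<le> norm v * (C * norm w)" for v w
  proof -
    have "b (v, w) \<in> D (v, w)" using b(1) unfolding K_def by (rule PiE_mem) simp
    then show ?thesis by (simp add: D_def abs_le_iff)
  qed
  have unique: "b (v, w) = l" if "((\<lambda>i. rinner v (blinfun_apply (X i) w)) \<longlongrightarrow> l) G" for v w l
    using tendsto_unique[OF G(1) lim that] .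
  have "\<exists>z. \<forall>v. b (v, w) = rinner v z" for w
  proof -
    have "bounded_linear (\<lambda>v. b (v, w))"
    proof (rule bounded_linear_intro)
      show "b (x + y, w) = b (x, w) + b (y, w)" for x y
        by (rule unique) (simp add: rinner.add_left tendsto_add lim)
      show "b (r *\<^sub>R x, w) = r *\<^sub>R b (x, w)" for r x
        by (rule unique) (simp add: rinner.scaleR_left tendsto_mult_left lim)
      show "norm (b (x, w)) \<le> norm x * (C * norm w)" for x
        using b_bound by simp
    qed
    then show ?thesis using riesz_representation rinner_commute by metis
  qed
  then obtain T where T: "\<And>v w. b (v, w) = rinner v (T w)" by metis
  have "bounded_linear T"
  proof (rule bounded_linear_intro)
    show "T (x + y) = T x + T y" for x y
    proof (rule rinner_eqI)
      show "rinner v (T (x + y)) = rinner v (T x + T y)" for v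
        unfolding rinner.add_right T[symmetric]
        by (rule unique) (simp add: rinner.add_right blinfun.add_right tendsto_add lim)
    qed
    show "T (r *\<^sub>R x) = r *\<^sub>R T x" for r x
    proof (rule rinner_eqI)
      show "rinner v (T (r *\<^sub>R x)) = rinner v (r *\<^sub>R T x)" for v
        unfolding rinner.scaleR_right T[symmetric]
        by (rule unique) (simp add: rinner.scaleR_right blinfun.scaleR_right tendsto_mult_left lim)
    qed
    show "norm (T x) \<le> norm x * C" for x
    proof (cases "T x = 0")
      case True
      have "0 \<le> C" using C norm_ge_zero order_trans by blast
      then show ?thesis using True by simp
    next
      case False
      have "norm (T x) * norm (T x) \<le> norm (T x) * (C * norm x)"
        using b_bound[of "T x" x] by (simp add: T rinner_self power2_eq_square)
      then show ?thesis using False by (simp add: mult.commute)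
    qed
  qed
  then have "((\<lambda>i. rinner v (blinfun_apply (X i) w)) \<longlongrightarrow> rinner v (blinfun_apply (Blinfun T) w)) G" for v w
    using lim by (simp add: bounded_linear_Blinfun_apply T)
  then show ?thesis using that G by blast
qed

text \<open>The spectrum lies in [0, C], and A is the polynomial X evaluated at A. This converts
  order bounds on the centres into the norm bound that compactness requires.\<close>

lemma norm_herm_le:
  assumes A: "A \<in> herm_ops" and C: "0 \<le> C"
    and "\<And>v. 0 \<le> rinner v (blinfun_apply A v)" "\<And>v. rinner v (blinfun_apply A v) \<le> C * (norm v)\<^sup>2"
  shows "norm A \<le> C"
proof -
  have "real_spectrum A \<subseteq> {0..}" "real_spectrum A \<subseteq> {..C}"
    using assms by (auto intro!: real_spectrum_lower real_spectrum_upper del: subsetI)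
  then have "norm (op_poly [:0, 1:] A) \<le> C"
    by (intro norm_op_poly_le A C) force
  then show ?thesis by (simp add: op_poly_linear)
qed

theorem lemma3p11:
  fixes U :: "('a::complex_hilbert_space \<Rightarrow>\<^sub>L 'a) set"
  assumes "U \<subseteq> pos_inv_ops"
    and "thompson_bounded U"
  shows "\<exists>r::real. circumradius U = ereal r \<and>
           (\<exists>x\<in>pos_inv_ops. \<forall>u\<in>U. thompson_dist x u \<le> r)"
proof -
  define S where "S = {r. 0 \<le> r \<and> (\<exists>x\<in>pos_inv_ops. U \<subseteq> thompson_cball x r)}"
  obtain x0 r0 where x0: "x0 \<in> pos_inv_ops" and "U \<subseteq> thompson_cball x0 r0"
    using assms(2) by (auto simp: thompson_bounded_def)
  \<comment> \<open>A negative r0 is possible when U is empty, while admissible radii are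
    nonnegative.\<close>
  then have "U \<subseteq> thompson_cball x0 (max 0 r0)"
    by (auto simp: thompson_cball_def)
  then have "max 0 r0 \<in> S"
    using x0 unfolding S_def by (intro CollectI conjI bexI[of _ x0]) auto
  then have S: "S \<noteq> {}" "bdd_below S"
    by blast (auto simp: S_def bdd_below_def)
  define R where "R = Inf S"
  have R: "circumradius U = ereal R"
    unfolding circumradius_def S_def[symmetric] R_def using ereal_Inf'[OF S(2,1)] by simp
  have "\<exists>x\<in>pos_inv_ops. \<forall>u\<in>U. thompson_dist x u \<le> R"
  proof (cases "U = {}")
    case True
    then show ?thesis using x0 by blast
  next
    case False
    \<comment> \<open>One element of U serves twice: it bounds the centres in norm from above and
      the limit form from below.\<close>
    then obtain u0 where u0: "u0 \<in> U" by blast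
    obtain c where u0h: "u0 \<in> herm_ops" and c: "0 < c" "\<And>v. c * (norm v)\<^sup>2 \<le> rinner v (blinfun_apply u0 v)"
      using pos_inv_ops_coercive u0 assms(1) by (metis subsetD)
    have R0: "0 \<le> R" unfolding R_def using S(1) by (intro cInf_greatest) (auto simp: S_def)
    have "\<exists>s\<in>S. s < R + inverse (Suc n)" for n
      using cInf_lessD[OF S(1), of "R + inverse (Suc n)"] by (simp add: R_def)
    then obtain s where s: "\<And>n. s n \<in> S" "\<And>n. s n < R + inverse (Suc n)" by metis
    have s_ge: "R \<le> s n" for n unfolding R_def using s(1) S(2) by (rule cInf_lower)
    have "\<exists>x\<in>pos_inv_ops. U \<subseteq> thompson_cball x (s n)" for n
      using s(1)[of n] by (simp add: S_def)
    then obtain X where X: "\<And>n. X n \<in> pos_inv_ops" "\<And>n. U \<subseteq> thompson_cball (X n) (s n)" by metis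
    have Xh: "X n \<in> herm_ops" for n using X(1) pos_inv_ops_coercive by metis
    have bounds: "exp (- s n) * rinner v (blinfun_apply (X n) v) \<le> rinner v (blinfun_apply u v)"
      "rinner v (blinfun_apply u v) \<le> exp (s n) * rinner v (blinfun_apply (X n) v)" if "u \<in> U" for u v n
    proof -
      have "thompson_dist (X n) u \<le> s n" using X(2) that by (auto simp: thompson_cball_def)
      then show "exp (- s n) * rinner v (blinfun_apply (X n) v) \<le> rinner v (blinfun_apply u v)"
        "rinner v (blinfun_apply u v) \<le> exp (s n) * rinner v (blinfun_apply (X n) v)"
        using thompson_dist_le_iff[OF X(1)] s_ge[of n] R0 assms(1) that by (meson order_trans subsetD)+
    qed
    have s_tendsto: "s \<longlonglongrightarrow> R"
    proof (rule tendsto_sandwich[of "\<lambda>_. R" s])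
      show "(\<lambda>n. R + inverse (real (Suc n))) \<longlonglongrightarrow> R"
        using tendsto_add[OF tendsto_const LIMSEQ_inverse_real_of_nat] by simp
    qed (use s s_ge in \<open>auto intro: always_eventually less_imp_le\<close>)
    \<comment> \<open>The form of X n is at most exp(s n) times that of u0, and s n < R + 1/(n+1)
      \<le> R + 1.\<close>
    have "norm (X n) \<le> exp (R + 1) * norm u0" for n
    proof (rule norm_herm_le[OF Xh])
      fix v
      show "0 \<le> rinner v (blinfun_apply (X n) v)"
        using pos_inv_ops_coercive[OF X(1)[of n]] by (metis less_imp_le mult_nonneg_nonneg order_trans zero_le_power2)
      have "inverse (real (Suc n)) \<le> 1" by (simp add: inverse_le_1_iff)
      then have "s n \<le> R + 1" using s(2)[of n] by linarith
      have u0v: "rinner v (blinfun_apply u0 v) \<le> norm u0 * (norm v)\<^sup>2"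
        using abs_rinner_blinfun_le[of v u0] by simp
      have "rinner v (blinfun_apply (X n) v) = exp (s n) * (exp (- s n) * rinner v (blinfun_apply (X n) v))"
        by (simp add: exp_minus)
      also have "\<dots> \<le> exp (s n) * (norm u0 * (norm v)\<^sup>2)"
        using bounds(1)[OF u0] u0v by (intro mult_left_mono) (auto intro: order_trans)
      also have "\<dots> \<le> exp (R + 1) * (norm u0 * (norm v)\<^sup>2)"
        using \<open>s n \<le> R + 1\<close> by (intro mult_right_mono) auto
      finally show "rinner v (blinfun_apply (X n) v) \<le> exp (R + 1) * norm u0 * (norm v)\<^sup>2"
        by (simp add: mult_ac)
    qed simp
    then obtain G B where G: "G \<noteq> bot" "G \<le> sequentially"
      and B: "\<And>v w. ((\<lambda>n. rinner v (blinfun_apply (X n) w)) \<longlongrightarrow> rinner v (blinfun_apply B w)) G"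
      using weak_operator_cluster_point[OF sequentially_bot, of X] by metis
    have sG: "(s \<longlongrightarrow> R) G" using s_tendsto G(2) by (rule filterlim_mono[OF _ order_refl])
    have Bh: "B \<in> herm_ops"
      by (rule herm_ops_weak_limit[OF G(1) _ B]) (simp add: Xh)
    have Bu: "exp (- R) * rinner v (blinfun_apply B v) \<le> rinner v (blinfun_apply u v)"
      "rinner v (blinfun_apply u v) \<le> exp R * rinner v (blinfun_apply B v)" if "u \<in> U" for u v
    proof -
      have "((\<lambda>n. exp (- s n) * rinner v (blinfun_apply (X n) v)) \<longlongrightarrow> exp (- R) * rinner v (blinfun_apply B v)) G"
        by (intro tendsto_intros sG B)
      then show "exp (- R) * rinner v (blinfun_apply B v) \<le> rinner v (blinfun_apply u v)"
        by (rule tendsto_upperbound[OF _ _ G(1)]) (simp add: bounds(1)[OF that])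
      have "((\<lambda>n. exp (s n) * rinner v (blinfun_apply (X n) v)) \<longlongrightarrow> exp R * rinner v (blinfun_apply B v)) G"
        by (intro tendsto_intros sG B)
      then show "rinner v (blinfun_apply u v) \<le> exp R * rinner v (blinfun_apply B v)"
        by (rule tendsto_lowerbound[OF _ _ G(1)]) (simp add: bounds(2)[OF that])
    qed
    have "B \<in> pos_inv_ops"
    proof (rule pos_inv_opsI[OF Bh])
      \<comment> \<open>The constant comes from c |v|^2 \<le> (v, u0 v) \<le> exp(R) (v, B
        v).\<close>
      show "0 < exp (- R) * c" using c(1) by simp
      show "exp (- R) * c * (norm v)\<^sup>2 \<le> rinner v (blinfun_apply B v)" for v
        using order_trans[OF c(2) Bu(2)[OF u0, of v]] by (simp add: exp_minus field_simps)
    qed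
    then show ?thesis
      using thompson_dist_le_iff[OF _ _ R0] Bu assms(1) by (meson subsetD)
  qed
  then show ?thesis using R by blast
qed

end
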